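(* Let $A$ be a finitely presented connected differential algebra over $\mathbb{Q}$ having nontrivial cohomology in some positive degree, let $k_0\ge 1$ be the smallest positive integer with $H^{k_0}(A)\neq 0$, and let $i\geq k_0$. If the sequential generator-adding method described in the context, applied to $A$ up to degree $i$, terminates, then the resulting differential algebra $M$ together with the resulting morphism $\phi:M\to A$ is an $i$-minimal model of $A$; that is, $M$ is $i$-minimal and $\phi$ is an $i$-quasi-isomorphism.
   Context: Differential algebra: a graded algebra $A=\bigoplus_{n\ge 0}A_n$ over $\mathbb{Q}$ with $A_mA_n\subseteq A_{m+n}$, graded commutative ($ab=(-1)^{mn}ba$ for $a\in A_m,b\in A_n$), with a linear map $d_A$ satisfying $d_A^2=0$, $d_A(A_n)\subseteq A_{n+1}$, $d_A(ab)=d_A(a)b+(-1)^m a\,d_A(b)$ for $a\in A_m$. Connected means $A_0=\mathbb{Q}$. Finitely presented means: the quotient of a free graded commutative algebra on finitely many homogeneous generators of positive degree by finitely many homogeneous relations, with the differential given on generators. Morphisms of differential algebras are algebra morphisms preserving degree and commuting with differentials. $M$ is $i$-minimal if it is freely generated (as a graded commutative algebra) by homogeneous elements $\{a_l\}_{l\in J}$ of positive degree, $J$ well-ordered, with $|a_l|\le|a_s|\le i$ for $l<s$, and $d(a_s)$ expressed in terms of the $a_l$ with $l<s$. A morphism $\phi:M\to A$ is an $i$-quasi-isomorphism if $\phi^*:H^j(M)\to H^j(A)$ is an isomorphism for all $j\le i$ and a monomorphism for $j=i+1$. An $i$-minimal model of $A$ is an $i$-minimal $M$ with an $i$-quasi-isomorphism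 $M\to A$. The method (up to degree $i$) builds a free differential algebra $M$ and a morphism $\phi:M\to A$ by successively adding free generators, specifying for each its degree, differential and image under $\phi$: (First step) Choose cocycles in $A$ representing a basis of $H^{k_0}(A)$; for each such cocycle $a$ add a generator $x$ of degree $k_0$ with $dx=0$, $\phi(x)=a$. Then for $k=k_0+1,\dots,i$ do the following two steps. ($y$-step for $k$) One iteration: let $\phi^*_k:H^k(M)\to H^k(A)$ be the map induced by the current $\phi$; choose cocycles $z_0,\dots,z_l\in M$ representing a basis of $\ker\phi^*_k$ and elements $b_j\in A_{k-1}$ with $d_A(b_j)=\phi(z_j)$; add generators $y_j$ of degree $k-1$ with $dy_j=z_j$, $\phi(y_j)=b_j$. Repeat iterations (with the updated $M$) until $\phi_k^*$ is injective; the step terminates if this happens after finitely many iterations. ($x$-step for $k$) Choose cocycles in $A_k$ whose classes complete a basis of $\operatorname{Im}\phi_k^*$ to a basis of $H^k(A)$; for each such cocycle $a$ add a generator $x$ of degree $k$ with $dx=0$, $\phi(x)=a$. Finally, perform the $y$-step for $k=i+1$. The method terminates if every $y$-step terminates. *)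

theory Defs
  imports Complex_Main "HOL-Algebra.QuotRing" "Jordan_Normal_Form.Missing_VectorSpace"
begin

section \<open>Differential algebras over the rationals\<close>

definition rat_field :: "rat ring" where
  "rat_field = \<lparr>carrier = UNIV, mult = (*), one = 1, zero = 0, add = (+)\<rparr>"

record 'a graded_alg = "(rat, 'a) module" +
  grade :: "nat \<Rightarrow> 'a set"

record 'a diff_alg = "'a graded_alg" +
  dif :: "'a \<Rightarrow> 'a"

locale graded_comm_algebra =
  fixes A :: "('a, 'e) graded_alg_scheme" (structure)
  assumes vector_space: "vectorspace rat_field A"
    and is_ring: "ring A"
    and smult_mult_left:
      "\<lbrakk>x \<in> carrier A; y \<in> carrier A\<rbrakk> \<Longrightarrow> (c \<odot> x) \<otimes> y = c \<odot> (x \<otimes> y)"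
    and smult_mult_right:
      "\<lbrakk>x \<in> carrier A; y \<in> carrier A\<rbrakk> \<Longrightarrow> x \<otimes> (c \<odot> y) = c \<odot> (x \<otimes> y)"
    and grade_subspace: "subspace rat_field (grade A n) A"
    and grade_direct_sum:
      "x \<in> carrier A \<Longrightarrow>
        \<exists>!f. (\<forall>n. f n \<in> grade A n) \<and> finite {n. f n \<noteq> \<zero>} \<and>
             x = (\<Oplus>n\<in>{n. f n \<noteq> \<zero>}. f n)"
    and grade_mult: "\<lbrakk>x \<in> grade A m; y \<in> grade A n\<rbrakk> \<Longrightarrow> x \<otimes> y \<in> grade A (m + n)"
    and graded_comm:
      "\<lbrakk>x \<in> grade A m; y \<in> grade A n\<rbrakk> \<Longrightarrow> x \<otimes> y = (-1) ^ (m * n) \<odot> (y \<otimes> x)"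

locale differential_algebra = graded_comm_algebra A
  for A :: "('a, 'e) diff_alg_scheme" (structure) +
  assumes dif_linear: "dif A \<in> module_hom rat_field A A"
    and dif_dif: "x \<in> carrier A \<Longrightarrow> dif A (dif A x) = \<zero>"
    and dif_grade: "x \<in> grade A n \<Longrightarrow> dif A x \<in> grade A (n + 1)"
    and dif_mult:
      "\<lbrakk>x \<in> grade A m; y \<in> carrier A\<rbrakk> \<Longrightarrow>
        dif A (x \<otimes> y) = dif A x \<otimes> y \<oplus> (-1) ^ m \<odot> (x \<otimes> dif A y)"

definition connected_algebra :: "('a, 'e) graded_alg_scheme \<Rightarrow> bool" where
  "connected_algebra A \<longleftrightarrow>
    \<one>\<^bsub>A\<^esub> \<noteq> \<zero>\<^bsub>A\<^esub> \<and> grade A 0 = range (\<lambda>c. c \<odot>\<^bsub>A\<^esub> \<one>\<^bsub>A\<^esub>)"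

definition graded_algebra_hom ::
  "('m, 'e) graded_alg_scheme \<Rightarrow> ('a, 'f) graded_alg_scheme \<Rightarrow> ('m \<Rightarrow> 'a) set" where
  "graded_algebra_hom M A =
    {f \<in> ring_hom M A \<inter> module_hom rat_field M A. \<forall>n. f ` grade M n \<subseteq> grade A n}"

definition diff_algebra_hom ::
  "('m, 'e) diff_alg_scheme \<Rightarrow> ('a, 'f) diff_alg_scheme \<Rightarrow> ('m \<Rightarrow> 'a) set" where
  "diff_algebra_hom M A =
    {f \<in> graded_algebra_hom M A. \<forall>x\<in>carrier M. f (dif M x) = dif A (f x)}"

inductive_set generated_subalgebra ::
  "('a, 'e) graded_alg_scheme \<Rightarrow> 'a set \<Rightarrow> 'a set"
  for A :: "('a, 'e) graded_alg_scheme" (structure) and S :: "'a set" where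
  one: "\<one> \<in> generated_subalgebra A S"
| gen: "x \<in> S \<Longrightarrow> x \<in> generated_subalgebra A S"
| smult: "x \<in> generated_subalgebra A S \<Longrightarrow> c \<odot> x \<in> generated_subalgebra A S"
| add: "\<lbrakk>x \<in> generated_subalgebra A S; y \<in> generated_subalgebra A S\<rbrakk>
    \<Longrightarrow> x \<oplus> y \<in> generated_subalgebra A S"
| mult: "\<lbrakk>x \<in> generated_subalgebra A S; y \<in> generated_subalgebra A S\<rbrakk>
    \<Longrightarrow> x \<otimes> y \<in> generated_subalgebra A S"


section \<open>Free graded commutative algebras\<close>

text \<open>The tensor algebra on the vector space with basis \<open>X\<close>, as non-commutative polynomials:
  finitely supported functions on words over \<open>X\<close> with the concatenation product.\<close>

definition word_poly :: "'x list \<Rightarrow> 'x list \<Rightarrow> rat" where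
  "word_poly w = (\<lambda>v. if v = w then 1 else 0)"

definition tensor_algebra :: "'x set \<Rightarrow> (rat, 'x list \<Rightarrow> rat) module" where
  "tensor_algebra X =
    \<lparr>carrier = {p. finite {w. p w \<noteq> 0} \<and> {w. p w \<noteq> 0} \<subseteq> lists X},
     mult = (\<lambda>p q w. \<Sum>k\<le>length w. p (take k w) * q (drop k w)),
     one = word_poly [],
     zero = (\<lambda>w. 0),
     add = (\<lambda>p q w. p w + q w),
     smult = (\<lambda>c p w. c * p w)\<rparr>"

text \<open>The free graded commutative algebra on generators \<open>X\<close> of degrees \<open>deg\<close> is the tensor
  algebra modulo the two-sided ideal generated by all \<open>xy - (-1)^(|x||y|) yx\<close>.  The case
  \<open>x = y\<close> of odd degree gives \<open>2 x\<^sup>2\<close>.\<close>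

definition commutator_ideal :: "'x set \<Rightarrow> ('x \<Rightarrow> nat) \<Rightarrow> ('x list \<Rightarrow> rat) set" where
  "commutator_ideal X deg =
    Idl\<^bsub>tensor_algebra X\<^esub>
      {\<lambda>w. word_poly [x, y] w - (-1) ^ (deg x * deg y) * word_poly [y, x] w
        | x y. x \<in> X \<and> y \<in> X}"

definition free_coset :: "'x set \<Rightarrow> ('x \<Rightarrow> nat) \<Rightarrow> ('x list \<Rightarrow> rat) \<Rightarrow> ('x list \<Rightarrow> rat) set" where
  "free_coset X deg p = commutator_ideal X deg +>\<^bsub>tensor_algebra X\<^esub> p"

definition free_graded_comm_algebra ::
  "'x set \<Rightarrow> ('x \<Rightarrow> nat) \<Rightarrow> ('x list \<Rightarrow> rat) set graded_alg" where
  "free_graded_comm_algebra X deg =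
    (let T = tensor_algebra X; Q = T Quot commutator_ideal X deg in
      \<lparr>carrier = carrier Q, mult = mult Q, one = one Q, zero = zero Q, add = add Q,
       smult = (\<lambda>c C. \<Union>p\<in>C. free_coset X deg (c \<odot>\<^bsub>T\<^esub> p)),
       grade = (\<lambda>n. free_coset X deg `
         {p \<in> carrier T. \<forall>w. p w \<noteq> 0 \<longrightarrow> sum_list (map deg w) = n})\<rparr>)"

definition freely_generated ::
  "('m, 'e) graded_alg_scheme \<Rightarrow> ('m \<Rightarrow> nat) \<Rightarrow> 'm set \<Rightarrow> bool" where
  "freely_generated M deg G \<longleftrightarrow>
    G \<subseteq> carrier M \<and> (\<forall>x\<in>G. 0 < deg x) \<and>
    (\<exists>\<psi> \<in> graded_algebra_hom (free_graded_comm_algebra G deg) M.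
      bij_betw \<psi> (carrier (free_graded_comm_algebra G deg)) (carrier M) \<and>
      (\<forall>x\<in>G. \<psi> (free_coset G deg (word_poly [x])) = x))"

text \<open>By the Leibniz rule the differential of a differential algebra presented in this way is
  determined by its values on the generators, so it adds no further condition.\<close>

definition finitely_presented :: "('a, 'e) graded_alg_scheme \<Rightarrow> bool" where
  "finitely_presented A \<longleftrightarrow>
    (\<exists>(X :: nat set) deg R \<pi>. let F = free_graded_comm_algebra X deg in
      finite X \<and> (\<forall>x\<in>X. 0 < deg x) \<and>
      finite R \<and> R \<subseteq> (\<Union>n. grade F n) \<and>
      \<pi> \<in> graded_algebra_hom F A \<and> \<pi> ` carrier F = carrier A \<and>
      a_kernel F A \<pi> = Idl\<^bsub>F\<^esub> R)"


section \<open>Cohomology\<close>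

definition cocycles :: "('a, 'e) diff_alg_scheme \<Rightarrow> nat \<Rightarrow> 'a set" where
  "cocycles A k = {z \<in> grade A k. dif A z = \<zero>\<^bsub>A\<^esub>}"

definition coboundaries :: "('a, 'e) diff_alg_scheme \<Rightarrow> nat \<Rightarrow> 'a set" where
  "coboundaries A k = (case k of 0 \<Rightarrow> {\<zero>\<^bsub>A\<^esub>} | Suc j \<Rightarrow> dif A ` grade A j)"

definition cohomology_class :: "('a, 'e) diff_alg_scheme \<Rightarrow> nat \<Rightarrow> 'a \<Rightarrow> 'a set" where
  "cohomology_class A k z = coboundaries A k +>\<^bsub>A\<^esub> z"

text \<open>Each \<open>H\<^sup>k\<close> is only used as a vector space; the fields \<open>mult\<close> and \<open>one\<close> carry no meaning.\<close>

definition cohomology :: "('a, 'e) diff_alg_scheme \<Rightarrow> nat \<Rightarrow> (rat, 'a set) module" where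
  "cohomology A k =
    \<lparr>carrier = cohomology_class A k ` cocycles A k,
     mult = (\<lambda>C D. coboundaries A k), one = coboundaries A k,
     zero = coboundaries A k, add = set_add A,
     smult = (\<lambda>c C. \<Union>z\<in>C. cohomology_class A k (c \<odot>\<^bsub>A\<^esub> z))\<rparr>"

definition nontrivial_cohomology :: "('a, 'e) diff_alg_scheme \<Rightarrow> nat \<Rightarrow> bool" where
  "nontrivial_cohomology A k \<longleftrightarrow> carrier (cohomology A k) \<noteq> {\<zero>\<^bsub>cohomology A k\<^esub>}"

definition induced_map ::
  "('a, 'f) diff_alg_scheme \<Rightarrow> ('m \<Rightarrow> 'a) \<Rightarrow> nat \<Rightarrow> 'm set \<Rightarrow> 'a set" where
  "induced_map A \<phi> k C = (\<Union>z\<in>C. cohomology_class A k (\<phi> z))"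

definition induced_ker ::
  "('m, 'e) diff_alg_scheme \<Rightarrow> ('a, 'f) diff_alg_scheme \<Rightarrow> ('m \<Rightarrow> 'a) \<Rightarrow> nat \<Rightarrow> 'm set set" where
  "induced_ker M A \<phi> k =
    {C \<in> carrier (cohomology M k). induced_map A \<phi> k C = \<zero>\<^bsub>cohomology A k\<^esub>}"

definition induced_image ::
  "('m, 'e) diff_alg_scheme \<Rightarrow> ('a, 'f) diff_alg_scheme \<Rightarrow> ('m \<Rightarrow> 'a) \<Rightarrow> nat \<Rightarrow> 'a set set" where
  "induced_image M A \<phi> k = induced_map A \<phi> k ` carrier (cohomology M k)"

definition induced_injective ::
  "('m, 'e) diff_alg_scheme \<Rightarrow> ('a, 'f) diff_alg_scheme \<Rightarrow> ('m \<Rightarrow> 'a) \<Rightarrow> nat \<Rightarrow> bool" where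
  "induced_injective M A \<phi> k \<longleftrightarrow> inj_on (induced_map A \<phi> k) (carrier (cohomology M k))"

definition cohomology_basis ::
  "('a, 'e) diff_alg_scheme \<Rightarrow> nat \<Rightarrow> 'a set set \<Rightarrow> 'a set set \<Rightarrow> bool" where
  "cohomology_basis A k W B \<longleftrightarrow> vectorspace.basis rat_field (cohomology A k\<lparr>carrier := W\<rparr>) B"


section \<open>Minimal models\<close>

text \<open>The free generators \<open>a\<^sub>l\<close> are pairwise distinct, so the set \<open>G\<close> of generators serves as
  its own index set, well-ordered by \<open>r\<close>.\<close>

definition i_minimal :: "nat \<Rightarrow> ('m, 'e) diff_alg_scheme \<Rightarrow> bool" where
  "i_minimal i M \<longleftrightarrow>
    differential_algebra M \<and>
    (\<exists>G deg r. freely_generated M deg G \<and> well_order_on G r \<and>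
      (\<forall>s\<in>G. deg s \<le> i) \<and>
      (\<forall>l s. (l, s) \<in> r \<and> l \<noteq> s \<longrightarrow> deg l \<le> deg s) \<and>
      (\<forall>s\<in>G. dif M s \<in> generated_subalgebra M {l. (l, s) \<in> r \<and> l \<noteq> s}))"

definition i_quasi_isomorphism ::
  "nat \<Rightarrow> ('m, 'e) diff_alg_scheme \<Rightarrow> ('a, 'f) diff_alg_scheme \<Rightarrow> ('m \<Rightarrow> 'a) \<Rightarrow> bool" where
  "i_quasi_isomorphism i M A \<phi> \<longleftrightarrow>
    \<phi> \<in> diff_algebra_hom M A \<and>
    (\<forall>j\<le>i. bij_betw (induced_map A \<phi> j) (carrier (cohomology M j)) (carrier (cohomology A j))) \<and>
    induced_injective M A \<phi> (i + 1)"

definition i_minimal_model ::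
  "nat \<Rightarrow> ('a, 'f) diff_alg_scheme \<Rightarrow> ('m, 'e) diff_alg_scheme \<Rightarrow> ('m \<Rightarrow> 'a) \<Rightarrow> bool" where
  "i_minimal_model i A M \<phi> \<longleftrightarrow> i_minimal i M \<and> i_quasi_isomorphism i M A \<phi>"


section \<open>The generator-adding method\<close>

text \<open>A state of the method is a free differential algebra \<open>M\<close>, its set \<open>G\<close> of free generators
  and a morphism \<open>\<phi>\<close> from \<open>M\<close> to \<open>A\<close>.  The following relation describes the addition of new
  free generators \<open>Y\<close> of degree \<open>n\<close>, with prescribed differentials \<open>z y\<close> in \<open>M\<close> and prescribed
  images \<open>b y\<close> in \<open>A\<close>: the old algebra is a differential subalgebra of the new one.\<close>

definition adds_generators ::
  "'a diff_alg \<Rightarrow> nat \<Rightarrow> 'm set \<Rightarrow> ('m \<Rightarrow> 'm) \<Rightarrow> ('m \<Rightarrow> 'a) \<Rightarrow>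
   'm diff_alg \<Rightarrow> 'm set \<Rightarrow> ('m \<Rightarrow> 'a) \<Rightarrow> 'm diff_alg \<Rightarrow> 'm set \<Rightarrow> ('m \<Rightarrow> 'a) \<Rightarrow> bool" where
  "adds_generators A n Y z b M G \<phi> M' G' \<phi>' \<longleftrightarrow>
    differential_algebra M' \<and> \<phi>' \<in> diff_algebra_hom M' A \<and>
    Y \<inter> G = {} \<and> G' = G \<union> Y \<and>
    (\<exists>deg. freely_generated M' deg G' \<and> (\<forall>y\<in>Y. deg y = n)) \<and>
    (\<lambda>m. m) \<in> diff_algebra_hom M M' \<and> (\<forall>m\<in>carrier M. \<phi>' m = \<phi> m) \<and>
    (\<forall>y\<in>Y. dif M' y = z y \<and> \<phi>' y = b y)"

definition first_step ::
  "'a diff_alg \<Rightarrow> nat \<Rightarrow> 'm diff_alg \<Rightarrow> 'm set \<Rightarrow> ('m \<Rightarrow> 'a) \<Rightarrow> bool" where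
  "first_step A k\<^sub>0 M G \<phi> \<longleftrightarrow>
    differential_algebra M \<and> \<phi> \<in> diff_algebra_hom M A \<and>
    (\<exists>deg. freely_generated M deg G \<and> (\<forall>x\<in>G. deg x = k\<^sub>0)) \<and>
    (\<forall>x\<in>G. dif M x = \<zero>\<^bsub>M\<^esub> \<and> \<phi> x \<in> cocycles A k\<^sub>0) \<and>
    inj_on (\<lambda>x. cohomology_class A k\<^sub>0 (\<phi> x)) G \<and>
    cohomology_basis A k\<^sub>0 (carrier (cohomology A k\<^sub>0))
      ((\<lambda>x. cohomology_class A k\<^sub>0 (\<phi> x)) ` G)"

definition y_iteration ::
  "'a diff_alg \<Rightarrow> nat \<Rightarrow> 'm diff_alg \<Rightarrow> 'm set \<Rightarrow> ('m \<Rightarrow> 'a) \<Rightarrow>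
   'm diff_alg \<Rightarrow> 'm set \<Rightarrow> ('m \<Rightarrow> 'a) \<Rightarrow> bool" where
  "y_iteration A k M G \<phi> M' G' \<phi>' \<longleftrightarrow>
    (\<exists>Y z b.
      (\<forall>y\<in>Y. z y \<in> cocycles M k) \<and>
      inj_on (\<lambda>y. cohomology_class M k (z y)) Y \<and>
      cohomology_basis M k (induced_ker M A \<phi> k) ((\<lambda>y. cohomology_class M k (z y)) ` Y) \<and>
      (\<forall>y\<in>Y. b y \<in> grade A (k - 1) \<and> dif A (b y) = \<phi> (z y)) \<and>
      adds_generators A (k - 1) Y z b M G \<phi> M' G' \<phi>')"

inductive y_step ::
  "'a diff_alg \<Rightarrow> nat \<Rightarrow> 'm diff_alg \<Rightarrow> 'm set \<Rightarrow> ('m \<Rightarrow> 'a) \<Rightarrow>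
   'm diff_alg \<Rightarrow> 'm set \<Rightarrow> ('m \<Rightarrow> 'a) \<Rightarrow> bool"
  for A :: "'a diff_alg" and k :: nat where
  stop: "induced_injective M A \<phi> k \<Longrightarrow> y_step A k M G \<phi> M G \<phi>"
| iterate: "\<lbrakk>\<not> induced_injective M A \<phi> k;
    y_iteration A k M G \<phi> M' G' \<phi>'; y_step A k M' G' \<phi>' M'' G'' \<phi>''\<rbrakk>
    \<Longrightarrow> y_step A k M G \<phi> M'' G'' \<phi>''"

definition x_step ::
  "'a diff_alg \<Rightarrow> nat \<Rightarrow> 'm diff_alg \<Rightarrow> 'm set \<Rightarrow> ('m \<Rightarrow> 'a) \<Rightarrow>
   'm diff_alg \<Rightarrow> 'm set \<Rightarrow> ('m \<Rightarrow> 'a) \<Rightarrow> bool" where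
  "x_step A k M G \<phi> M' G' \<phi>' \<longleftrightarrow>
    (\<exists>X a B.
      cohomology_basis A k (induced_image M A \<phi> k) B \<and>
      (\<forall>x\<in>X. a x \<in> cocycles A k) \<and>
      inj_on (\<lambda>x. cohomology_class A k (a x)) X \<and>
      B \<inter> (\<lambda>x. cohomology_class A k (a x)) ` X = {} \<and>
      cohomology_basis A k (carrier (cohomology A k))
        (B \<union> (\<lambda>x. cohomology_class A k (a x)) ` X) \<and>
      adds_generators A k X (\<lambda>x. \<zero>\<^bsub>M\<^esub>) a M G \<phi> M' G' \<phi>')"

inductive reached_after_x_step ::
  "'a diff_alg \<Rightarrow> nat \<Rightarrow> nat \<Rightarrow> 'm diff_alg \<Rightarrow> 'm set \<Rightarrow> ('m \<Rightarrow> 'a) \<Rightarrow> bool"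
  for A :: "'a diff_alg" and k\<^sub>0 :: nat where
  first: "first_step A k\<^sub>0 M G \<phi> \<Longrightarrow> reached_after_x_step A k\<^sub>0 k\<^sub>0 M G \<phi>"
| next_degree: "\<lbrakk>reached_after_x_step A k\<^sub>0 k M G \<phi>;
    y_step A (k + 1) M G \<phi> M' G' \<phi>'; x_step A (k + 1) M' G' \<phi>' M'' G'' \<phi>''\<rbrakk>
    \<Longrightarrow> reached_after_x_step A k\<^sub>0 (k + 1) M'' G'' \<phi>''"

text \<open>The method leaves choices open; this holds if some sequence of choices makes the method,
  up to degree \<open>i\<close>, terminate with the algebra \<open>M\<close>, free on \<open>G\<close>, and the morphism \<open>\<phi>\<close>.\<close>

definition method_terminates_with ::
  "'a diff_alg \<Rightarrow> nat \<Rightarrow> nat \<Rightarrow> 'm diff_alg \<Rightarrow> 'm set \<Rightarrow> ('m \<Rightarrow> 'a) \<Rightarrow> bool" where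
  "method_terminates_with A k\<^sub>0 i M G \<phi> \<longleftrightarrow>
    (\<exists>M' G' \<phi>'. reached_after_x_step A k\<^sub>0 i M' G' \<phi>' \<and> y_step A (i + 1) M' G' \<phi>' M G \<phi>)"

end

theory Submission
  imports Defs
begin

text \<open>
  Adjoining generators of degree \<open>n\<close> to a free algebra \<open>M\<close> changes nothing below degree \<open>n\<close>, and
  adds to \<open>M\<^sub>n\<close> only the linear span of the new generators.  Hence a new cochain of degree \<open>n\<close> has
  the form \<open>m + \<Sum> c\<^sub>y y\<close>.  In a \<open>y\<close>-step for \<open>n + 1\<close>, closedness means \<open>dm + \<Sum> c\<^sub>y z\<^sub>y = 0\<close>, so the
  linear independence of the classes of the \<open>z\<^sub>y\<close> forces all \<open>c\<^sub>y = 0\<close>: no new cocycles appear and the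
  cohomology is unchanged up to degree \<open>n\<close>.  In an \<open>x\<close>-step for \<open>n\<close>, the new cocycles hit a
  complement of the image of the cohomology of \<open>M\<close>, on which the induced map was already injective,
  and so it becomes bijective in degree \<open>n\<close>.  The degrees of the successive generators never decrease,
  so ordering them by the time of their addition proves minimality.
\<close>

section \<open>Tensor algebras and free graded commutative algebras\<close>

text \<open>No basis of a free algebra is ever constructed. Every element is the value of a
  non-commutative polynomial in the generators, and the shape of the enlarged algebra in low degrees
  follows by counting letters: as degrees are positive, a word of weight below n contains no letter
  of degree n, and a word of weight n contains one only as its sole letter. Surjectivity of
  evaluation does not show that degrees are intrinsic. Adjoining generators provides some degree
  function on the enlarged generating set, with no stated link to the previous one on old
  generators. The two agree because a nonzero element has at most one degree, and generators are
  nonzero because the graded commutators generate an ideal without constant or linear terms. An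
  off-by-one shapes the induction: coboundaries of degree n come from degree n - 1, so new
  generators of degree n leave them alone, whereas coboundaries of degree n + 1 may grow. This is
  how a y-step kills classes, and why injectivity in degree n + 1 is read off from its stopping
  condition.\<close>

lemma carrier_tensor_algebra:
  "carrier (tensor_algebra X) = {p. finite {w. p w \<noteq> 0} \<and> {w. p w \<noteq> 0} \<subseteq> lists X}"
  and mult_tensor_algebra:
  "mult (tensor_algebra X) = (\<lambda>p q w. \<Sum>k\<le>length w. p (take k w) * q (drop k w))"
  and one_tensor_algebra: "one (tensor_algebra X) = word_poly []"
  and zero_tensor_algebra: "zero (tensor_algebra X) = (\<lambda>w. 0)"
  and add_tensor_algebra: "add (tensor_algebra X) = (\<lambda>p q w. p w + q w)"
  and smult_tensor_algebra: "smult (tensor_algebra X) = (\<lambda>c p w. c * p w)"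
  by (simp_all add: tensor_algebra_def)

lemmas tensor_algebra_simps = carrier_tensor_algebra mult_tensor_algebra one_tensor_algebra
  zero_tensor_algebra add_tensor_algebra smult_tensor_algebra

lemma word_poly_closed: "w \<in> lists X \<Longrightarrow> word_poly w \<in> carrier (tensor_algebra X)"
  by (auto simp: carrier_tensor_algebra word_poly_def)

lemma tensor_algebra_add_closed:
  assumes "p \<in> carrier (tensor_algebra X)" "q \<in> carrier (tensor_algebra X)"
  shows "(\<lambda>w. p w + q w) \<in> carrier (tensor_algebra X)"
proof -
  have "{w. p w + q w \<noteq> 0} \<subseteq> {w. p w \<noteq> 0} \<union> {w. q w \<noteq> 0}" by auto
  then show ?thesis
    using assms by (auto simp: carrier_tensor_algebra intro: finite_subset)
qed

lemma tensor_algebra_smult_closed: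
  "p \<in> carrier (tensor_algebra X) \<Longrightarrow> (\<lambda>w. c * p w) \<in> carrier (tensor_algebra X)"
  by (auto simp: carrier_tensor_algebra intro: rev_finite_subset)

lemma restrict_poly_closed:
  "p \<in> carrier (tensor_algebra X) \<Longrightarrow> (\<lambda>w. if Q w then p w else 0) \<in> carrier (tensor_algebra X)"
  by (auto simp: carrier_tensor_algebra intro: rev_finite_subset)

lemma tensor_algebra_mult_closed:
  assumes "p \<in> carrier (tensor_algebra X)" "q \<in> carrier (tensor_algebra X)"
  shows "(\<lambda>w. \<Sum>k\<le>length w. p (take k w) * q (drop k w)) \<in> carrier (tensor_algebra X)"
proof -
  let ?r = "\<lambda>w. \<Sum>k\<le>length w. p (take k w) * q (drop k w)"
  have sub: "{w. ?r w \<noteq> 0} \<subseteq> (\<lambda>(u, v). u @ v) ` ({w. p w \<noteq> 0} \<times> {w. q w \<noteq> 0})"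
  proof
    fix w assume "w \<in> {w. ?r w \<noteq> 0}"
    then obtain k where "p (take k w) * q (drop k w) \<noteq> 0"
      by (metis (mono_tags, lifting) mem_Collect_eq sum.neutral)
    then show "w \<in> (\<lambda>(u, v). u @ v) ` ({w. p w \<noteq> 0} \<times> {w. q w \<noteq> 0})"
      by (intro image_eqI[where x = "(take k w, drop k w)"]) auto
  qed
  moreover have "(\<lambda>(u, v). u @ v) ` ({w. p w \<noteq> 0} \<times> {w. q w \<noteq> 0}) \<subseteq> lists X"
    using assms by (fastforce simp: carrier_tensor_algebra)
  ultimately show ?thesis
    using assms finite_subset[OF sub] by (auto simp: carrier_tensor_algebra)
qed

text \<open>Both sides sum over all ways of cutting \<open>w\<close> into three consecutive pieces;
  only the order in which the two cuts are made differs.\<close>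

lemma tensor_algebra_mult_assoc:
  fixes p q r :: "'x list \<Rightarrow> rat"
  shows "(\<Sum>k\<le>length w. (\<Sum>j\<le>length (take k w). p (take j (take k w)) * q (drop j (take k w)))
             * r (drop k w)) =
    (\<Sum>j\<le>length w. p (take j w) *
       (\<Sum>k\<le>length (drop j w). q (take k (drop j w)) * r (drop k (drop j w))))"
proof -
  let ?n = "length w"
  have "(\<Sum>k\<le>?n. (\<Sum>j\<le>length (take k w). p (take j (take k w)) * q (drop j (take k w)))
             * r (drop k w)) =
    (\<Sum>k\<le>?n. \<Sum>j\<le>k. p (take j w) * q (take (k - j) (drop j w)) * r (drop k w))"
    by (intro sum.cong refl) (auto simp: sum_distrib_right min_def drop_take)
  also have "\<dots> = (\<Sum>(k, j)\<in>Sigma {..?n} (\<lambda>k. {..k}).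
      p (take j w) * q (take (k - j) (drop j w)) * r (drop k w))"
    by (simp add: sum.Sigma)
  also have "\<dots> = (\<Sum>(j, k)\<in>Sigma {..?n} (\<lambda>j. {..?n - j}).
      p (take j w) * q (take k (drop j w)) * r (drop (j + k) w))"
    \<comment> \<open>On the left \<open>(k, j)\<close> are the positions of the later and the
      earlier cut; on the right \<open>(j, k)\<close> are the earlier cut and the length of the
      middle piece.\<close>
    by (rule sum.reindex_bij_witness[where i = "\<lambda>(j, k). (j + k, j)" and j = "\<lambda>(k, j). (j, k - j)"])
      auto
  also have "\<dots> = (\<Sum>j\<le>?n. p (take j w) *
       (\<Sum>k\<le>length (drop j w). q (take k (drop j w)) * r (drop k (drop j w))))"
    by (simp add: sum.Sigma[symmetric] sum_distrib_left mult.assoc add.commute)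
  finally show ?thesis .
qed

lemma tensor_algebra_l_one:
  "(\<Sum>k\<le>length w. word_poly [] (take k w) * p (drop k w)) = p w"
proof -
  have "(\<Sum>k\<le>length w. word_poly [] (take k w) * p (drop k w)) =
    (\<Sum>k\<le>length w. if k = 0 then p w else 0)"
    by (intro sum.cong refl) (auto simp: word_poly_def)
  then show ?thesis by simp
qed

lemma tensor_algebra_r_one:
  "(\<Sum>k\<le>length w. p (take k w) * word_poly [] (drop k w)) = p w"
proof -
  have "(\<Sum>k\<le>length w. p (take k w) * word_poly [] (drop k w)) =
    (\<Sum>k\<le>length w. if k = length w then p w else 0)"
    by (intro sum.cong refl) (auto simp: word_poly_def)
  then show ?thesis by simp
qed

lemma ring_tensor_algebra: "ring (tensor_algebra X)"
proof (rule ringI)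
  show "abelian_group (tensor_algebra X)"
  proof (rule abelian_groupI)
    fix p assume p: "p \<in> carrier (tensor_algebra X)"
    show "\<exists>q\<in>carrier (tensor_algebra X). q \<oplus>\<^bsub>tensor_algebra X\<^esub> p = \<zero>\<^bsub>tensor_algebra X\<^esub>"
      using tensor_algebra_smult_closed[OF p, of "-1"]
      by (intro bexI[of _ "\<lambda>w. - 1 * p w"]) (simp_all add: tensor_algebra_simps)
  qed (auto simp: add_tensor_algebra zero_tensor_algebra tensor_algebra_add_closed,
       simp add: carrier_tensor_algebra)
next
  show "monoid (tensor_algebra X)"
  proof (rule monoidI)
    show "x \<otimes>\<^bsub>tensor_algebra X\<^esub> y \<in> carrier (tensor_algebra X)"
      if "x \<in> carrier (tensor_algebra X)" "y \<in> carrier (tensor_algebra X)" for x y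
      unfolding mult_tensor_algebra using that by (rule tensor_algebra_mult_closed)
    show "x \<otimes>\<^bsub>tensor_algebra X\<^esub> y \<otimes>\<^bsub>tensor_algebra X\<^esub> z =
        x \<otimes>\<^bsub>tensor_algebra X\<^esub> (y \<otimes>\<^bsub>tensor_algebra X\<^esub> z)" for x y z
      unfolding mult_tensor_algebra by (rule ext, rule tensor_algebra_mult_assoc)
    show "\<one>\<^bsub>tensor_algebra X\<^esub> \<in> carrier (tensor_algebra X)"
      by (simp add: one_tensor_algebra word_poly_closed)
    show "\<one>\<^bsub>tensor_algebra X\<^esub> \<otimes>\<^bsub>tensor_algebra X\<^esub> x = x"
      "x \<otimes>\<^bsub>tensor_algebra X\<^esub> \<one>\<^bsub>tensor_algebra X\<^esub> = x" for x
      by (simp_all only: mult_tensor_algebra one_tensor_algebra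
          tensor_algebra_l_one tensor_algebra_r_one)
  qed
qed (auto simp: mult_tensor_algebra add_tensor_algebra sum.distrib algebra_simps)

lemma word_poly_mult:
  "word_poly u \<otimes>\<^bsub>tensor_algebra X\<^esub> word_poly v = word_poly (u @ v)"
proof
  fix w
  have "(word_poly u \<otimes>\<^bsub>tensor_algebra X\<^esub> word_poly v) w =
    (\<Sum>k\<le>length w. if k = length u then if w = u @ v then 1 else 0 else 0)"
    unfolding mult_tensor_algebra
  proof (intro sum.cong refl)
    fix k assume "k \<in> {..length w}"
    then have "take k w = u \<and> drop k w = v \<longleftrightarrow> k = length u \<and> w = u @ v"
      by (metis append_eq_conv_conj atMost_iff append_take_drop_id length_take min.absorb2)
    then show "word_poly u (take k w) * word_poly v (drop k w) =
        (if k = length u then if w = u @ v then 1 else 0 else 0)"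
      unfolding word_poly_def by (smt (verit) mult_cancel_right1 mult_eq_0_iff)
  qed
  also have "\<dots> = word_poly (u @ v) w"
    by (simp add: word_poly_def)
  finally show "(word_poly u \<otimes>\<^bsub>tensor_algebra X\<^esub> word_poly v) w = word_poly (u @ v) w" .
qed

text \<open>Induction on the finite support, removing one monomial at a time. The set
  \<open>S\<close> carries a restriction on the words that occur, for instance to words over fewer
  letters.\<close>

lemma tensor_algebra_induct [consumes 2, case_names zero add]:
  assumes "p \<in> carrier (tensor_algebra X)" "{w. p w \<noteq> 0} \<subseteq> S"
    and zero: "P (\<lambda>w. 0)"
    and add: "\<And>c w p. \<lbrakk>w \<in> S; w \<in> lists X; p \<in> carrier (tensor_algebra X);
      {w. p w \<noteq> 0} \<subseteq> S; P p\<rbrakk> \<Longrightarrow> P (\<lambda>v. c * word_poly w v + p v)"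
  shows "P p"
proof -
  have "finite {w. p w \<noteq> 0}" using assms by (simp add: carrier_tensor_algebra)
  then show ?thesis using assms(1,2)
  proof (induction "{w. p w \<noteq> 0}" arbitrary: p rule: finite_psubset_induct)
    case psubset
    show ?case
    proof (cases "{w. p w \<noteq> 0} = {}")
      case True
      then have "p = (\<lambda>w. 0)" by auto
      with zero show ?thesis by simp
    next
      case False
      then obtain w where w: "p w \<noteq> 0" by auto
      define q where "q = p(w := 0)"
      have q: "{v. q v \<noteq> 0} = {v. p v \<noteq> 0} - {w}" by (auto simp: q_def)
      with psubset.prems have "q \<in> carrier (tensor_algebra X)" "{v. q v \<noteq> 0} \<subseteq> S"
        by (auto simp: carrier_tensor_algebra)
      moreover have "{v. q v \<noteq> 0} \<subset> {v. p v \<noteq> 0}" using w q by auto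
      ultimately have "P (\<lambda>v. p w * word_poly w v + q v)"
        using psubset.hyps(2)[of q] w psubset.prems by (intro add) (auto simp: carrier_tensor_algebra)
      moreover have "(\<lambda>v. p w * word_poly w v + q v) = p"
        by (auto simp: q_def word_poly_def)
      ultimately show ?thesis by simp
    qed
  qed
qed

section \<open>The commutator ideal has no terms of length at most one\<close>

lemma commutator_closed:
  assumes "x \<in> X" "y \<in> X"
  shows "(\<lambda>w. word_poly [x, y] w - c * word_poly [y, x] w) \<in> carrier (tensor_algebra X)"
  using tensor_algebra_add_closed[OF word_poly_closed
      tensor_algebra_smult_closed[OF word_poly_closed], of "[x, y]" X "[y, x]" "- c"] assms
  by simp

lemma ideal_commutator_ideal: "ideal (commutator_ideal X deg) (tensor_algebra X)"
  unfolding commutator_ideal_def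
  by (rule ring.genideal_ideal[OF ring_tensor_algebra]) (auto intro: commutator_closed)

text \<open>Concatenation never shortens words: a coefficient of a product at a word of length at
  most 1 only involves coefficients of the factors at words that are no longer.\<close>

lemma ideal_no_constant_linear_part:
  "ideal {p \<in> carrier (tensor_algebra X). \<forall>w. length w \<le> 1 \<longrightarrow> p w = 0} (tensor_algebra X)"
    (is "ideal ?J ?T")
proof -
  interpret T: ring ?T by (rule ring_tensor_algebra)
  show ?thesis
  proof (rule idealI[OF ring_tensor_algebra])
    show "subgroup ?J (add_monoid ?T)"
    proof
      fix p assume p: "p \<in> ?J"
      have "\<ominus>\<^bsub>?T\<^esub> p = (\<lambda>w. - 1 * p w)"
        by (rule T.minus_equality)
          (use p tensor_algebra_smult_closed[of p X "-1"] in \<open>auto simp: tensor_algebra_simps\<close>)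
      then show "inv\<^bsub>add_monoid ?T\<^esub> p \<in> ?J"
        using p tensor_algebra_smult_closed[of p X "-1"] by (simp add: a_inv_def)
    qed (auto simp: add_tensor_algebra zero_tensor_algebra tensor_algebra_add_closed,
         simp add: carrier_tensor_algebra)
  next
    fix a x assume a: "a \<in> ?J" and x: "x \<in> carrier ?T"
    show "x \<otimes>\<^bsub>?T\<^esub> a \<in> ?J" "a \<otimes>\<^bsub>?T\<^esub> x \<in> ?J"
      using a x by (auto intro!: T.m_closed, auto simp: mult_tensor_algebra intro!: sum.neutral)
  qed
qed

text \<open>The generating commutators are purely quadratic, so the ideal of polynomials with terms
  of length at least 2 contains them all. This is the substitute for a basis of the free
  algebra.\<close>

lemma commutator_ideal_no_linear_part:
  assumes "p \<in> commutator_ideal X deg" "length w \<le> 1"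
  shows "p w = 0"
proof -
  let ?J = "{p \<in> carrier (tensor_algebra X). \<forall>w. length w \<le> 1 \<longrightarrow> p w = 0}"
  have "commutator_ideal X deg \<subseteq> ?J"
    unfolding commutator_ideal_def
  proof (rule ring.genideal_minimal[OF ring_tensor_algebra ideal_no_constant_linear_part], clarify)
    fix x y assume "x \<in> X" "y \<in> X"
    then show "(\<lambda>w. word_poly [x, y] w - (-1) ^ (deg x * deg y) * word_poly [y, x] w)
        \<in> carrier (tensor_algebra X) \<and> (\<forall>w. length w \<le> 1 \<longrightarrow>
          word_poly [x, y] w - (-1) ^ (deg x * deg y) * word_poly [y, x] w = 0)"
      by (simp add: commutator_closed) (auto simp: word_poly_def)
  qed
  with assms show ?thesis by blast
qed

lemma carrier_rat_field [simp]: "carrier rat_field = UNIV"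
  and zero_rat_field [simp]: "zero rat_field = 0"
  by (simp_all add: rat_field_def)

section \<open>Computing with cosets in the free graded commutative algebra\<close>

lemma carrier_free_algebra:
  "carrier (free_graded_comm_algebra X deg) = free_coset X deg ` carrier (tensor_algebra X)"
  by (auto simp: free_graded_comm_algebra_def Let_def FactRing_def A_RCOSETS_def' free_coset_def)

lemma grade_free_algebra:
  "grade (free_graded_comm_algebra X deg) n = free_coset X deg `
     {p \<in> carrier (tensor_algebra X). \<forall>w. p w \<noteq> 0 \<longrightarrow> sum_list (map deg w) = n}"
  by (simp add: free_graded_comm_algebra_def Let_def)

lemma free_coset_mult:
  assumes "p \<in> carrier (tensor_algebra X)" "q \<in> carrier (tensor_algebra X)"
  shows "free_coset X deg p \<otimes>\<^bsub>free_graded_comm_algebra X deg\<^esub> free_coset X deg q =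
    free_coset X deg (p \<otimes>\<^bsub>tensor_algebra X\<^esub> q)"
  using ideal.rcoset_mult_add[OF ideal_commutator_ideal assms]
  by (simp add: free_graded_comm_algebra_def Let_def FactRing_def free_coset_def)

lemma free_coset_add:
  assumes "p \<in> carrier (tensor_algebra X)" "q \<in> carrier (tensor_algebra X)"
  shows "free_coset X deg p \<oplus>\<^bsub>free_graded_comm_algebra X deg\<^esub> free_coset X deg q =
    free_coset X deg (\<lambda>w. p w + q w)"
  using abelian_subgroup.a_rcos_sum[OF abelian_subgroupI3[OF
      ideal.axioms(1)[OF ideal_commutator_ideal] ring.is_abelian_group[OF ring_tensor_algebra]] assms]
  by (simp add: free_graded_comm_algebra_def Let_def FactRing_def free_coset_def add_tensor_algebra)

lemma free_coset_one:
  "\<one>\<^bsub>free_graded_comm_algebra X deg\<^esub> = free_coset X deg (word_poly [])"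
  by (simp add: free_graded_comm_algebra_def Let_def FactRing_def free_coset_def one_tensor_algebra)

lemma a_r_coset_eq_iff:
  assumes "ring R" "abelian_subgroup H R" "x \<in> carrier R" "y \<in> carrier R"
  shows "H +>\<^bsub>R\<^esub> x = H +>\<^bsub>R\<^esub> y \<longleftrightarrow> x \<ominus>\<^bsub>R\<^esub> y \<in> H"
proof -
  interpret H: abelian_subgroup H R by fact
  show ?thesis
    using H.a_rcos_module_minus[OF assms(1,4,3)] H.a_repr_independence'[OF _ assms(4)]
      H.a_repr_independenceD[OF assms(3)] by metis
qed

lemma abelian_subgroup_commutator_ideal:
  "abelian_subgroup (commutator_ideal X deg) (tensor_algebra X)"
  by (rule abelian_subgroupI3[OF ideal.axioms(1)[OF ideal_commutator_ideal]
      ring.is_abelian_group[OF ring_tensor_algebra]])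

lemma free_coset_eq_iff:
  assumes "p \<in> carrier (tensor_algebra X)" "q \<in> carrier (tensor_algebra X)"
  shows "free_coset X deg p = free_coset X deg q \<longleftrightarrow>
    p \<ominus>\<^bsub>tensor_algebra X\<^esub> q \<in> commutator_ideal X deg"
  unfolding free_coset_def
  by (rule a_r_coset_eq_iff[OF ring_tensor_algebra abelian_subgroup_commutator_ideal assms])

lemma tensor_algebra_minus:
  assumes "p \<in> carrier (tensor_algebra X)" "q \<in> carrier (tensor_algebra X)"
  shows "p \<ominus>\<^bsub>tensor_algebra X\<^esub> q = (\<lambda>w. p w - q w)"
proof -
  interpret T: ring "tensor_algebra X" by (rule ring_tensor_algebra)
  have "\<ominus>\<^bsub>tensor_algebra X\<^esub> q = (\<lambda>w. - 1 * q w)"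
    by (rule T.minus_equality)
      (use assms tensor_algebra_smult_closed[of q X "-1"] in \<open>auto simp: tensor_algebra_simps\<close>)
  then show ?thesis
    by (simp add: a_minus_def add_tensor_algebra)
qed

text \<open>Scalars act as constant polynomials, so a ring ideal is automatically closed under
  scalar multiplication.\<close>

lemma tensor_algebra_smult_eq_mult:
  "(\<lambda>w. c * p w) = (\<lambda>w. c * word_poly [] w) \<otimes>\<^bsub>tensor_algebra X\<^esub> p"
proof -
  have "((\<lambda>w. c * word_poly [] w) \<otimes>\<^bsub>tensor_algebra X\<^esub> p) w =
    c * (\<Sum>k\<le>length w. word_poly [] (take k w) * p (drop k w))" for w
    by (simp add: mult_tensor_algebra sum_distrib_left mult.assoc)
  then show ?thesis by (simp add: tensor_algebra_l_one fun_eq_iff)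
qed

lemma free_coset_smult:
  assumes p: "p \<in> carrier (tensor_algebra X)"
  shows "c \<odot>\<^bsub>free_graded_comm_algebra X deg\<^esub> free_coset X deg p =
    free_coset X deg (\<lambda>w. c * p w)"
proof -
  let ?T = "tensor_algebra X" and ?I = "commutator_ideal X deg"
  interpret T: ring ?T by (rule ring_tensor_algebra)
  interpret I: ideal ?I ?T by (rule ideal_commutator_ideal)
  \<comment> \<open>Scalar multiplication of a coset is a union over its representatives; it is a
    single coset only because all representatives yield the same one.\<close>
  have same: "free_coset X deg (\<lambda>w. c * q w) = free_coset X deg (\<lambda>w. c * p w)"
    if q: "q \<in> free_coset X deg p" for q
  proof -
    have qc: "q \<in> carrier ?T"
      using q p T.a_r_coset_subset_G[OF I.a_subset] unfolding free_coset_def by blast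
    have "free_coset X deg q = free_coset X deg p"
      using I.a_repr_independence'[OF _ p] q unfolding free_coset_def by blast
    then have "(\<lambda>w. q w - p w) \<in> ?I"
      using free_coset_eq_iff[OF qc p] tensor_algebra_minus[OF qc p] by simp
    then have "(\<lambda>w. c * word_poly [] w) \<otimes>\<^bsub>?T\<^esub> (\<lambda>w. q w - p w) \<in> ?I"
      by (rule I.I_l_closed) (simp add: tensor_algebra_smult_closed word_poly_closed)
    then have "(\<lambda>w. c * q w - c * p w) \<in> ?I"
      by (simp add: tensor_algebra_smult_eq_mult[symmetric] right_diff_distrib)
    then show ?thesis
      using qc p tensor_algebra_smult_closed[of _ X c]
      by (simp add: free_coset_eq_iff tensor_algebra_minus)
  qed
  have "p \<in> free_coset X deg p"
    unfolding free_coset_def using p by (rule I.a_rcos_self)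
  then have "(\<Union>q\<in>free_coset X deg p. free_coset X deg (\<lambda>w. c * q w)) =
      free_coset X deg (\<lambda>w. c * p w)"
    using same by blast
  then show ?thesis
    by (simp add: free_graded_comm_algebra_def Let_def smult_tensor_algebra)
qed

lemma free_coset_eqD:
  assumes "free_coset X deg p = free_coset X deg q"
    and "p \<in> carrier (tensor_algebra X)" "q \<in> carrier (tensor_algebra X)" "length w \<le> 1"
  shows "p w = q w"
  using commutator_ideal_no_linear_part[of "\<lambda>w. p w - q w" X deg w] assms
  by (simp add: free_coset_eq_iff tensor_algebra_minus)

section \<open>Homogeneous components\<close>

context graded_comm_algebra
begin

lemma grade_submodule: "submodule rat_field (grade A n) A"
  using grade_subspace by (rule subspace.submod)

lemma grade_closed: "x \<in> grade A n \<Longrightarrow> x \<in> carrier A"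
  using submodule.subset[OF grade_submodule] by auto

lemma zero_in_grade: "\<zero> \<in> grade A n"
  by (rule submodule.zero_closed[OF grade_submodule])

lemma grade_add: "x \<in> grade A n \<Longrightarrow> y \<in> grade A n \<Longrightarrow> x \<oplus> y \<in> grade A n"
  by (rule submodule.m_closed[OF grade_submodule])

lemma grade_smult: "x \<in> grade A n \<Longrightarrow> c \<odot> x \<in> grade A n"
  by (rule submodule.smult_closed[OF grade_submodule]) auto

text \<open>A homogeneous \<open>x\<close> also has the decomposition \<open>g\<close> concentrated
  in degree \<open>n\<close>; uniqueness of decompositions identifies it with
  \<open>f\<close>.\<close>

lemma grade_component:
  assumes f: "\<And>m. f m \<in> grade A m" and fin: "finite {m. f m \<noteq> \<zero>}"
    and x: "x \<in> grade A n" "x = (\<Oplus>m\<in>{m. f m \<noteq> \<zero>}. f m)"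
  shows "x = f n"
proof -
  interpret ring A by (rule is_ring)
  define g where "g = (\<lambda>m. if m = n then x else \<zero>)"
  have supp: "{m. g m \<noteq> \<zero>} = (if x = \<zero> then {} else {n})"
    by (auto simp: g_def)
  have "(\<Oplus>m\<in>{m. g m \<noteq> \<zero>}. g m) = x"
    unfolding supp using grade_closed[OF x(1)] by (simp add: g_def)
  moreover have "g m \<in> grade A m" for m
    using x zero_in_grade by (simp add: g_def)
  moreover have "finite {m. g m \<noteq> \<zero>}" by (simp add: supp)
  ultimately have "g = f"
    using grade_direct_sum[OF grade_closed[OF x(1)]] f fin x(2) by blast
  then show ?thesis by (auto simp: g_def)
qed

lemma grade_unique:
  assumes "x \<in> grade A m" "x \<in> grade A n" "x \<noteq> \<zero>"
  shows "m = n"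
proof -
  interpret ring A by (rule is_ring)
  have supp: "{k. (if k = m then x else \<zero>) \<noteq> \<zero>} = {m}"
    using assms by auto
  have "x = (if n = m then x else \<zero>)"
    by (rule grade_component)
      (use assms zero_in_grade grade_closed[OF assms(1)] in \<open>auto simp: supp\<close>)
  with assms show ?thesis by (metis)
qed

end

text \<open>\<open>E\<close> is the map from non-commutative polynomials in the generators to the algebra they freely
  generate.  Of the freeness only the injectivity on constant and linear terms is retained:
  this is all that is needed to see that the degrees of the generators are well determined.\<close>

locale free_evaluation = graded_comm_algebra M
  for M :: "('m, 'e) graded_alg_scheme" (structure) and deg :: "'m \<Rightarrow> nat" and G :: "'m set" and E +
  assumes deg_pos: "x \<in> G \<Longrightarrow> 0 < deg x"
    and E_one: "E (word_poly []) = \<one>"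
    and E_add: "\<lbrakk>p \<in> carrier (tensor_algebra G); q \<in> carrier (tensor_algebra G)\<rbrakk>
      \<Longrightarrow> E (\<lambda>w. p w + q w) = E p \<oplus> E q"
    and E_mult: "\<lbrakk>p \<in> carrier (tensor_algebra G); q \<in> carrier (tensor_algebra G)\<rbrakk>
      \<Longrightarrow> E (p \<otimes>\<^bsub>tensor_algebra G\<^esub> q) = E p \<otimes> E q"
    and E_smult: "p \<in> carrier (tensor_algebra G) \<Longrightarrow> E (\<lambda>w. c * p w) = c \<odot> E p"
    and E_gen: "x \<in> G \<Longrightarrow> E (word_poly [x]) = x"
    and E_onto: "E ` carrier (tensor_algebra G) = carrier M"
    and E_eqD: "\<lbrakk>E p = E q; p \<in> carrier (tensor_algebra G); q \<in> carrier (tensor_algebra G);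
      length w \<le> 1\<rbrakk> \<Longrightarrow> p w = q w"
    and E_grade: "\<lbrakk>p \<in> carrier (tensor_algebra G); \<forall>w. p w \<noteq> 0 \<longrightarrow> sum_list (map deg w) = n\<rbrakk>
      \<Longrightarrow> E p \<in> grade M n"

text \<open>\<open>E\<close> is the projection onto the free algebra followed by the isomorphism
  \<open>\<psi>\<close>. Injectivity of \<open>\<psi>\<close> turns equal values into equal cosets,
  and these determine the constant and linear coefficients.\<close>

lemma freely_generated_evaluation:
  assumes "graded_comm_algebra M" "freely_generated M deg G"
  obtains E where "free_evaluation M deg G E"
proof -
  let ?F = "free_graded_comm_algebra G deg" and ?T = "tensor_algebra G"
  interpret T: ring ?T by (rule ring_tensor_algebra)
  from assms(2) obtain \<psi> where pos: "\<forall>x\<in>G. 0 < deg x"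
    and hom: "\<psi> \<in> graded_algebra_hom ?F M"
    and bij: "bij_betw \<psi> (carrier ?F) (carrier M)"
    and gen: "\<And>x. x \<in> G \<Longrightarrow> \<psi> (free_coset G deg (word_poly [x])) = x"
    unfolding freely_generated_def by blast
  from hom have ring: "\<psi> \<in> ring_hom ?F M" and mod: "\<psi> \<in> module_hom rat_field ?F M"
    and grade: "\<And>n. \<psi> ` grade ?F n \<subseteq> grade M n"
    by (auto simp: graded_algebra_hom_def)
  have F: "free_coset G deg p \<in> carrier ?F" if "p \<in> carrier ?T" for p
    using that by (simp add: carrier_free_algebra)
  define E where "E = \<psi> \<circ> free_coset G deg"
  have "free_evaluation M deg G E"
  proof (rule free_evaluation.intro[OF assms(1)], unfold_locales)
    fix p q assume pq: "p \<in> carrier ?T" "q \<in> carrier ?T"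
    show "E (\<lambda>w. p w + q w) = E p \<oplus>\<^bsub>M\<^esub> E q"
      using ring_hom_add[OF ring F F] pq by (simp add: E_def free_coset_add)
    show "E (p \<otimes>\<^bsub>?T\<^esub> q) = E p \<otimes>\<^bsub>M\<^esub> E q"
      using ring_hom_mult[OF ring F F] pq by (simp add: E_def free_coset_mult)
    show "E (\<lambda>w. c * p w) = c \<odot>\<^bsub>M\<^esub> E p" for c
      using module_hom_smult[OF mod _ F] pq(1) by (simp add: E_def free_coset_smult)
    show "p w = q w" if "E p = E q" "length w \<le> 1" for w
    proof (rule free_coset_eqD)
      show "free_coset G deg p = free_coset G deg q"
        using that bij_betw_imp_inj_on[OF bij] F pq by (auto simp: E_def inj_on_def)
    qed (use that pq in auto)
    show "E p \<in> grade M n" if "\<forall>w. p w \<noteq> 0 \<longrightarrow> sum_list (map deg w) = n" for n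
      using that grade[of n] pq(1) by (auto simp: E_def grade_free_algebra)
  next
    show "E (word_poly []) = \<one>\<^bsub>M\<^esub>"
      using ring_hom_one[OF ring] by (simp add: E_def free_coset_one)
    show "E ` carrier ?T = carrier M"
      using bij_betw_imp_surj_on[OF bij] by (simp add: E_def carrier_free_algebra image_comp)
  qed (use pos gen in \<open>auto simp: E_def\<close>)
  then show thesis by (rule that)
qed

section \<open>Evaluating polynomials in the generators\<close>

context free_evaluation
begin

lemma gen_poly: "x \<in> G \<Longrightarrow> word_poly [x] \<in> carrier (tensor_algebra G)"
  by (simp add: word_poly_closed)

lemma zero_poly: "(\<lambda>w. 0) \<in> carrier (tensor_algebra G)"
  by (simp add: carrier_tensor_algebra)

lemma E_closed: "p \<in> carrier (tensor_algebra G) \<Longrightarrow> E p \<in> carrier M"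
  using E_onto by blast

lemma gen_closed: "x \<in> G \<Longrightarrow> x \<in> carrier M"
  using E_closed[OF gen_poly] by (simp add: E_gen)

lemma gen_grade: "x \<in> G \<Longrightarrow> x \<in> grade M (deg x)"
  using E_grade[OF gen_poly, of x "deg x"]
  by (simp only: E_gen) (simp add: word_poly_def)

lemma E_zero: "E (\<lambda>w. 0) = \<zero>"
proof -
  interpret V: vectorspace rat_field M by (rule vector_space)
  show ?thesis
    using E_smult[OF zero_poly, of 0] V.lmult_0[OF E_closed[OF zero_poly]] by simp
qed

lemma gen_nonzero: "x \<in> G \<Longrightarrow> x \<noteq> \<zero>"
  using E_eqD[OF _ gen_poly zero_poly, of x "[x]"]
  by (simp only: E_gen E_zero) (auto simp: word_poly_def)

lemma E_Cons:
  assumes "x \<in> G" "w \<in> lists G"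
  shows "E (word_poly (x # w)) = x \<otimes> E (word_poly w)"
  using E_mult[OF gen_poly word_poly_closed, of x w] assms by (simp add: word_poly_mult E_gen)

lemma E_monomial_add:
  assumes "w \<in> lists G" "p \<in> carrier (tensor_algebra G)"
  shows "E (\<lambda>v. c * word_poly w v + p v) = c \<odot> E (word_poly w) \<oplus> E p"
  using assms by (simp add: E_add E_smult tensor_algebra_smult_closed word_poly_closed)

lemma E_in_generated_subalgebra:
  assumes "p \<in> carrier (tensor_algebra G)" "{w. p w \<noteq> 0} \<subseteq> lists S" "S \<subseteq> G"
  shows "E p \<in> generated_subalgebra M S"
  using assms(1,2)
proof (induction rule: tensor_algebra_induct)
  case zero
  interpret V: vectorspace rat_field M by (rule vector_space)
  interpret R: ring M by (rule is_ring)
  \<comment> \<open>Zero is not among the introduction rules of the generated subalgebra; it enters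
    as a multiple of 1.\<close>
  have "\<zero> = 0 \<odot> \<one>" using V.lmult_0[OF R.one_closed] by simp
  then show ?case unfolding E_zero by (metis generated_subalgebra.one generated_subalgebra.smult)
next
  case (add c w p)
  have "w \<in> lists G \<Longrightarrow> w \<in> lists S \<Longrightarrow> E (word_poly w) \<in> generated_subalgebra M S"
  proof (induction w)
    case Nil
    then show ?case by (simp add: E_one generated_subalgebra.one)
  next
    case (Cons x w)
    then show ?case
      by (auto simp: E_Cons intro: generated_subalgebra.mult generated_subalgebra.gen)
  qed
  with add show ?case
    by (auto simp: E_monomial_add intro!: generated_subalgebra.add generated_subalgebra.smult)
qed

lemma carrier_generated: "carrier M \<subseteq> generated_subalgebra M G"
proof
  fix x assume "x \<in> carrier M"
  then obtain p where "p \<in> carrier (tensor_algebra G)" "x = E p" using E_onto by blast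
  then show "x \<in> generated_subalgebra M G"
    using E_in_generated_subalgebra[of p G] by (simp add: carrier_tensor_algebra)
qed

text \<open>A preimage of a homogeneous element under \<open>E\<close> need not be homogeneous.
  Splitting it by weight of words gives a homogeneous decomposition of \<open>x\<close>, and by
  uniqueness the part of weight \<open>n\<close> alone already evaluates to
  \<open>x\<close>.\<close>

lemma grade_eval:
  assumes "x \<in> grade M n"
  obtains p where "p \<in> carrier (tensor_algebra G)"
    "\<forall>w. p w \<noteq> 0 \<longrightarrow> sum_list (map deg w) = n" "E p = x"
proof -
  interpret R: ring M by (rule is_ring)
  let ?d = "\<lambda>w. sum_list (map deg w)"
  obtain p where p: "p \<in> carrier (tensor_algebra G)" "x = E p"
    using grade_closed[OF assms] E_onto by blast
  define f where "f m = E (\<lambda>w. if ?d w = m then p w else 0)" for m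
  have fg: "f m \<in> grade M m" for m
    unfolding f_def by (intro E_grade restrict_poly_closed p) auto
  define D where "D = ?d ` {w. p w \<noteq> 0}"
  have fin: "finite D" using p by (simp add: D_def carrier_tensor_algebra)
  have sum: "E (\<lambda>w. if ?d w \<in> N then p w else 0) = (\<Oplus>m\<in>N. f m)" if "finite N" for N
    using that
  proof (induction N)
    case empty
    then show ?case by (simp add: E_zero)
  next
    case (insert m N)
    have "(\<lambda>w. if ?d w \<in> insert m N then p w else 0) =
      (\<lambda>w. (if ?d w = m then p w else 0) + (if ?d w \<in> N then p w else 0))"
      using insert by auto
    then have "E (\<lambda>w. if ?d w \<in> insert m N then p w else 0) =
      f m \<oplus> E (\<lambda>w. if ?d w \<in> N then p w else 0)"
      unfolding f_def by (simp only:) (intro E_add restrict_poly_closed p)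
    with insert grade_closed[OF fg] show ?case by (simp add: R.finsum_insert)
  qed
  \<comment> \<open>Words of weight \<open>m\<close> may occur in \<open>p\<close> and still
    evaluate to zero together, so the support of \<open>f\<close> can be smaller than
    \<open>D\<close>.\<close>
  have supp: "{m. f m \<noteq> \<zero>} \<subseteq> D"
  proof
    fix m assume m: "m \<in> {m. f m \<noteq> \<zero>}"
    show "m \<in> D"
    proof (rule ccontr)
      assume "m \<notin> D"
      then have "(\<lambda>w. if ?d w = m then p w else 0) = (\<lambda>w. 0)"
        by (fastforce simp: D_def)
      with m show False by (simp add: f_def E_zero)
    qed
  qed
  have eq: "(\<lambda>w. if ?d w \<in> D then p w else 0) = p" by (fastforce simp: D_def)
  have "x = (\<Oplus>m\<in>D. f m)" using sum[OF fin] p(2) unfolding eq by simp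
  also have "\<dots> = (\<Oplus>m\<in>{m. f m \<noteq> \<zero>}. f m)"
    by (rule R.add.finprod_mono_neutral_cong_right) (use fin supp grade_closed[OF fg] in auto)
  finally have "x = f n"
    using grade_component[OF fg finite_subset[OF supp fin] assms] by blast
  then show thesis
    using restrict_poly_closed[OF p(1), of "\<lambda>w. ?d w = n"]
    by (intro that[of "\<lambda>w. if ?d w = n then p w else 0"]) (auto simp: f_def split: if_splits)
qed

lemma E_linear:
  assumes "finite F" "F \<subseteq> G"
  shows "(\<lambda>w. \<Sum>y\<in>F. c y * word_poly [y] w) \<in> carrier (tensor_algebra G) \<and>
    E (\<lambda>w. \<Sum>y\<in>F. c y * word_poly [y] w) = (\<Oplus>y\<in>F. c y \<odot> y)"
  using assms
proof (induction F)
  interpret R: ring M by (rule is_ring)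
  case empty
  show ?case by (simp add: E_zero zero_poly)
next
  interpret R: ring M by (rule is_ring)
  interpret V: vectorspace rat_field M by (rule vector_space)
  case (insert x F)
  have "(\<lambda>y. c y \<odot> y) \<in> F \<rightarrow> carrier M" "c x \<odot> x \<in> carrier M"
    using insert gen_closed by (auto intro!: V.smult_closed)
  with insert show ?case
    by (simp add: E_monomial_add E_gen R.finsum_insert tensor_algebra_add_closed
        tensor_algebra_smult_closed gen_poly)
qed

text \<open>Every letter of a word has degree at most the weight of the word, so letters of degree
  above \<open>j\<close> cannot occur.\<close>

lemma poly_below_degree:
  assumes p: "p \<in> carrier (tensor_algebra G)" "\<forall>w. p w \<noteq> 0 \<longrightarrow> sum_list (map deg w) = j"
    and G0: "\<And>x. x \<in> G - G0 \<Longrightarrow> j < deg x"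
  shows "p \<in> carrier (tensor_algebra G0)"
proof -
  have "w \<in> lists G0" if "p w \<noteq> 0" for w
  proof -
    have "w \<in> lists G" "sum_list (map deg w) = j"
      using p that by (auto simp: carrier_tensor_algebra)
    then have "x \<in> G0" if "x \<in> set w" for x
      using that G0[of x] member_le_sum_list[of "deg x" "map deg w"] by fastforce
    then show ?thesis by auto
  qed
  with p show ?thesis by (auto simp: carrier_tensor_algebra)
qed

text \<open>If a word of weight \<open>n\<close> contains a letter of degree \<open>n\<close>, the
  remaining letters have total degree 0; as degrees are positive, there are none. Letters outside
  \<open>G0\<close> therefore appear only in one-letter words.\<close>

lemma poly_at_degree:
  assumes p: "p \<in> carrier (tensor_algebra G)" "\<forall>w. p w \<noteq> 0 \<longrightarrow> sum_list (map deg w) = n"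
    and Y: "\<And>y. y \<in> G - G0 \<Longrightarrow> deg y = n" and G0: "G0 \<subseteq> G"
  obtains q F c where "q \<in> carrier (tensor_algebra G0)"
    "\<forall>w. q w \<noteq> 0 \<longrightarrow> sum_list (map deg w) = n"
    "finite F" "F \<subseteq> G - G0" "E p = E q \<oplus> (\<Oplus>y\<in>F. c y \<odot> y)"
proof -
  \<comment> \<open>\<open>q\<close> collects the words in old letters, and \<open>F\<close> the new
    letters that occur alone; the coefficient of \<open>y\<close> is \<open>p [y]\<close>.\<close>
  define q where "q = (\<lambda>w. if w \<in> lists G0 then p w else 0)"
  define F where "F = {y \<in> G - G0. p [y] \<noteq> 0}"
  have "(\<lambda>y. [y]) ` F \<subseteq> {w. p w \<noteq> 0}" by (auto simp: F_def)
  moreover have "finite {w. p w \<noteq> 0}" using p by (simp add: carrier_tensor_algebra)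
  ultimately have fin: "finite F"
    by (metis finite_subset finite_imageD inj_onI list.inject)
  have single: "\<exists>y\<in>F. w = [y]" if w: "p w \<noteq> 0" "w \<notin> lists G0" for w
  proof -
    have wG: "w \<in> lists G" and d: "sum_list (map deg w) = n"
      using p w by (auto simp: carrier_tensor_algebra)
    obtain y where y: "y \<in> set w" "y \<notin> G0" using w by auto
    with wG have "deg y = n" using Y by auto
    moreover obtain u v where uv: "w = u @ y # v" using y by (meson split_list)
    ultimately have "sum_list (map deg u) = 0" "sum_list (map deg v) = 0" using d by auto
    then have "\<forall>x\<in>set u. deg x = 0" "\<forall>x\<in>set v. deg x = 0" by auto
    moreover have "\<forall>x\<in>set u \<union> set v. deg x > 0" using wG uv deg_pos by auto
    ultimately have "u = []" "v = []" by (metis UnCI last_in_set less_irrefl)+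
    with uv y w wG show ?thesis by (auto simp: F_def)
  qed
  have "p w = q w + (\<Sum>y\<in>F. p [y] * word_poly [y] w)" for w
  proof (cases "\<exists>y\<in>F. w = [y]")
    case True
    then obtain y where y: "y \<in> F" "w = [y]" by blast
    have "(\<Sum>x\<in>F. p [x] * word_poly [x] w) = (\<Sum>x\<in>F. if x = y then p [y] else 0)"
      using y by (intro sum.cong) (auto simp: word_poly_def)
    with y fin show ?thesis by (auto simp: q_def F_def)
  next
    case False
    then have "(\<Sum>y\<in>F. p [y] * word_poly [y] w) = 0"
      by (intro sum.neutral) (auto simp: word_poly_def)
    with False single[of w] show ?thesis by (auto simp: q_def)
  qed
  then have eq: "p = (\<lambda>w. q w + (\<Sum>y\<in>F. p [y] * word_poly [y] w))" by (rule ext)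
  have qG: "q \<in> carrier (tensor_algebra G)"
    unfolding q_def using p(1) by (rule restrict_poly_closed)
  show thesis
  proof (rule that)
    show "q \<in> carrier (tensor_algebra G0)"
      using qG by (auto simp: q_def carrier_tensor_algebra split: if_splits)
    show "\<forall>w. q w \<noteq> 0 \<longrightarrow> sum_list (map deg w) = n" using p by (auto simp: q_def)
    show "finite F" "F \<subseteq> G - G0" using fin by (auto simp: F_def)
    have "F \<subseteq> G" by (auto simp: F_def)
    then have "E (\<lambda>w. q w + (\<Sum>y\<in>F. p [y] * word_poly [y] w)) = E q \<oplus> (\<Oplus>y\<in>F. p [y] \<odot> y)"
      using E_add[OF qG] E_linear[OF fin, of "\<lambda>y. p [y]"] by simp
    then show "E p = E q \<oplus> (\<Oplus>y\<in>F. p [y] \<odot> y)"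
      by (rule trans[OF arg_cong[where f = E, OF eq]])
  qed
qed

text \<open>With positive degrees the empty word is the only one of weight 0. This settles degree 0
  of the comparison with a connected algebra.\<close>

lemma grade_zero_eq: "grade M 0 = range (\<lambda>c. c \<odot> \<one>)"
proof
  show "grade M 0 \<subseteq> range (\<lambda>c. c \<odot> \<one>)"
  proof
    fix x assume "x \<in> grade M 0"
    then obtain p where p: "p \<in> carrier (tensor_algebra G)"
      "\<forall>w. p w \<noteq> 0 \<longrightarrow> sum_list (map deg w) = 0" "E p = x" by (rule grade_eval)
    have "p \<in> carrier (tensor_algebra {})"
      using p(1,2) by (rule poly_below_degree) (simp add: deg_pos)
    then have "p w = p [] * word_poly [] w" for w
      by (cases w) (auto simp: carrier_tensor_algebra word_poly_def)
    then have eq: "p = (\<lambda>w. p [] * word_poly [] w)" by (rule ext)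
    have "E (\<lambda>w. p [] * word_poly [] w) = p [] \<odot> \<one>"
      using E_smult[OF word_poly_closed, of "[]" "p []"] by (simp add: E_one)
    then have "E p = p [] \<odot> \<one>"
      by (rule trans[OF arg_cong[where f = E, OF eq]])
    then have "x = p [] \<odot> \<one>" by (simp add: p(3))
    then show "x \<in> range (\<lambda>c. c \<odot> \<one>)" by auto
  qed
  have "\<one> \<in> grade M 0"
    using E_grade[OF word_poly_closed, of "[]" 0]
    by (simp only: E_one) (simp add: word_poly_def)
  then show "range (\<lambda>c. c \<odot> \<one>) \<subseteq> grade M 0" by (auto intro: grade_smult)
qed

lemma grade_below_trivial:
  assumes "0 < j" "\<And>x. x \<in> G \<Longrightarrow> j < deg x" "x \<in> grade M j"
  shows "x = \<zero>"
proof -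
  obtain p where p: "p \<in> carrier (tensor_algebra G)"
      "\<forall>w. p w \<noteq> 0 \<longrightarrow> sum_list (map deg w) = j" "E p = x"
    using assms(3) by (rule grade_eval)
  have "p \<in> carrier (tensor_algebra {})"
    using p(1,2) by (rule poly_below_degree) (simp add: assms)
  with p(2) assms(1) have "p w = 0" for w
    by (cases w) (auto simp: carrier_tensor_algebra)
  then have "p = (\<lambda>w. 0)" by auto
  with p(3) show ?thesis by (simp add: E_zero)
qed

end

section \<open>Cohomology\<close>

text \<open>Since \<open>S\<close> and \<open>T\<close> are disjoint, a representation of
  \<open>v\<close> over \<open>S\<close> and the coefficients \<open>c\<close> glue to one
  combination with sum zero; a nonzero \<open>c x\<close> would make it a dependence.\<close>

lemma (in module) lin_indpt_disjoint_span:
  assumes "lin_indpt (S \<union> T)" "S \<union> T \<subseteq> carrier M" "S \<inter> T = {}"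
    and "finite F" "F \<subseteq> T" "c \<in> F \<rightarrow> carrier R" "v \<in> span S"
    and eq: "v \<oplus>\<^bsub>M\<^esub> lincomb c F = \<zero>\<^bsub>M\<^esub>" and x: "x \<in> F"
  shows "c x = \<zero>\<^bsub>R\<^esub>"
proof (rule ccontr)
  assume nz: "c x \<noteq> \<zero>\<^bsub>R\<^esub>"
  from \<open>v \<in> span S\<close> obtain a B where B: "finite B" "B \<subseteq> S" "a \<in> B \<rightarrow> carrier R" "v = lincomb a B"
    unfolding span_def by blast
  let ?d = "\<lambda>w. if w \<in> B then a w else c w"
  have disj: "B \<inter> F = {}" using B assms by blast
  have "lincomb ?d (B \<union> F) = \<zero>\<^bsub>M\<^esub>"
    using B assms disj by (subst lincomb_union2[of B F a c, symmetric]) auto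
  then have "lin_dep (S \<union> T)"
    by (intro lin_dep_crit[of "B \<union> F" _ ?d x]) (use B assms disj nz in auto)
  with assms show False by simp
qed

lemma mem_a_r_coset_iff:
  "x \<in> H +>\<^bsub>R\<^esub> a \<longleftrightarrow> (\<exists>h\<in>H. x = h \<oplus>\<^bsub>R\<^esub> a)"
  by (auto simp: a_r_coset_def')

section \<open>Cohomology groups as rational vector spaces\<close>

context differential_algebra
begin

lemma module_A: "module rat_field A"
  using vector_space by (rule vectorspace.axioms)

lemma mod_hom_dif: "mod_hom rat_field A A (dif A)"
  by (intro mod_hom.intro mod_hom_axioms.intro module_A dif_linear)

lemma smult_closed: "x \<in> carrier A \<Longrightarrow> c \<odot> x \<in> carrier A"
  using module.smult_closed[OF module_A] by simp

lemma dif_zero: "dif A \<zero> = \<zero>"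
  by (rule mod_hom.f0_is_0[OF mod_hom_dif])

lemma dif_add: "x \<in> carrier A \<Longrightarrow> y \<in> carrier A \<Longrightarrow> dif A (x \<oplus> y) = dif A x \<oplus> dif A y"
  by (rule module_hom_add[OF dif_linear])

lemma dif_smult: "x \<in> carrier A \<Longrightarrow> dif A (c \<odot> x) = c \<odot> dif A x"
  using module_hom_smult[OF dif_linear] by simp

text \<open>The Leibniz rule for the product of 1 with itself gives
  \<open>d 1 = d 1 + d 1\<close>.\<close>

lemma dif_one: assumes "\<one> \<in> grade A 0" shows "dif A \<one> = \<zero>"
proof -
  interpret ring A by (rule is_ring)
  interpret V: module rat_field A by (rule module_A)
  have c: "dif A \<one> \<in> carrier A" using dif_grade[OF assms] by (rule grade_closed)
  have "dif A \<one> = dif A \<one> \<oplus> dif A \<one>"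
    using dif_mult[OF assms one_closed] V.smult_one[OF c] c by (simp add: rat_field_def)
  with c show ?thesis by (metis add.r_cancel_one')
qed

lemma cocycles_submodule: "submodule rat_field (cocycles A k) A"
proof -
  interpret ring A by (rule is_ring)
  interpret V: module rat_field A by (rule module_A)
  show ?thesis
    by (rule submodule.intro[OF module_A])
      (auto simp: cocycles_def grade_closed zero_in_grade grade_add grade_smult
        dif_zero dif_add dif_smult V.smult_r_null)
qed

lemma coboundaries_submodule: "submodule rat_field (coboundaries A k) A"
proof -
  interpret ring A by (rule is_ring)
  interpret V: module rat_field A by (rule module_A)
  show ?thesis
  proof (cases k)
    case 0
    then show ?thesis
      by (intro submodule.intro[OF module_A]) (auto simp: coboundaries_def V.smult_r_null)
  next
    case (Suc j)
    show ?thesis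
    proof (rule submodule.intro[OF module_A])
      fix v w assume "v \<in> coboundaries A k" "w \<in> coboundaries A k"
      then show "v \<oplus> w \<in> coboundaries A k"
        by (auto simp: coboundaries_def Suc dif_add[symmetric] grade_closed grade_add)
    next
      fix c v assume "v \<in> coboundaries A k"
      then show "c \<odot> v \<in> coboundaries A k"
        by (auto simp: coboundaries_def Suc dif_smult[symmetric] grade_closed grade_smult)
    next
      show "\<zero> \<in> coboundaries A k"
        unfolding coboundaries_def Suc
        by (simp, rule rev_image_eqI[OF zero_in_grade]) (simp add: dif_zero)
    qed (auto simp: coboundaries_def Suc dest: dif_grade grade_closed)
  qed
qed

lemma cocycles_closed: "z \<in> cocycles A k \<Longrightarrow> z \<in> carrier A"
  by (auto simp: cocycles_def grade_closed)

lemmas cocycles_add = submodule.m_closed[OF cocycles_submodule]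
  and cocycles_smult = submodule.smult_closed[OF cocycles_submodule, simplified]
  and zero_in_cocycles = submodule.zero_closed[OF cocycles_submodule]
  and coboundaries_add = submodule.m_closed[OF coboundaries_submodule]
  and coboundaries_smult = submodule.smult_closed[OF coboundaries_submodule, simplified]
  and zero_in_coboundaries = submodule.zero_closed[OF coboundaries_submodule]

lemma abelian_subgroup_coboundaries: "abelian_subgroup (coboundaries A k) A"
proof (rule abelian_subgroupI3)
  interpret ring A by (rule is_ring)
  interpret V: module rat_field A by (rule module_A)
  interpret B: submodule rat_field "coboundaries A k" A by (rule coboundaries_submodule)
  show "abelian_group A" by unfold_locales
  show "additive_subgroup (coboundaries A k) A"
  proof (rule additive_subgroup.intro, rule add.subgroupI)
    show "\<ominus> a \<in> coboundaries A k" if "a \<in> coboundaries A k" for a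
      using that B.subset V.smult_minus_1[of a] coboundaries_smult[OF that]
      by (metis UNIV_I carrier_rat_field subsetD)
    show "coboundaries A k \<noteq> {}" using B.zero_closed by blast
  qed (use B.subset in auto)
qed

lemma class_eq_iff:
  "\<lbrakk>x \<in> carrier A; y \<in> carrier A\<rbrakk> \<Longrightarrow>
    cohomology_class A k x = cohomology_class A k y \<longleftrightarrow> x \<ominus> y \<in> coboundaries A k"
  unfolding cohomology_class_def
  by (rule a_r_coset_eq_iff[OF is_ring abelian_subgroup_coboundaries])

lemma class_zero: "cohomology_class A k \<zero> = coboundaries A k"
  unfolding cohomology_class_def
  by (rule abelian_subgroup.a_rcos_const[OF abelian_subgroup_coboundaries zero_in_coboundaries])

lemma class_eq_zero_iff:
  assumes "x \<in> carrier A"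
  shows "cohomology_class A k x = coboundaries A k \<longleftrightarrow> x \<in> coboundaries A k"
proof -
  interpret ring A by (rule is_ring)
  show ?thesis
    using class_eq_iff[OF assms zero_closed] assms by (simp add: class_zero a_minus_def)
qed

lemma mem_class: "x \<in> carrier A \<Longrightarrow> x \<in> cohomology_class A k x"
  unfolding cohomology_class_def
  by (rule abelian_subgroup.a_rcos_self[OF abelian_subgroup_coboundaries])

lemma mem_classD:
  assumes "y \<in> cohomology_class A k x"
  shows "\<exists>b\<in>coboundaries A k. y = b \<oplus> x"
  using assms by (simp add: cohomology_class_def mem_a_r_coset_iff)

lemma class_coboundary_add:
  assumes "b \<in> coboundaries A k" "x \<in> carrier A"
  shows "cohomology_class A k (b \<oplus> x) = cohomology_class A k x"
proof -
  interpret ring A by (rule is_ring)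
  have "b \<in> carrier A" using assms submodule.subset[OF coboundaries_submodule] by auto
  with assms show ?thesis by (simp add: class_eq_iff a_minus_def a_assoc r_neg)
qed

lemma class_add:
  "\<lbrakk>x \<in> carrier A; y \<in> carrier A\<rbrakk> \<Longrightarrow> cohomology_class A k x \<oplus>\<^bsub>cohomology A k\<^esub>
    cohomology_class A k y = cohomology_class A k (x \<oplus> y)"
  by (simp add: cohomology_def cohomology_class_def
      abelian_subgroup.a_rcos_sum[OF abelian_subgroup_coboundaries])

lemma class_smult:
  assumes "x \<in> carrier A"
  shows "c \<odot>\<^bsub>cohomology A k\<^esub> cohomology_class A k x = cohomology_class A k (c \<odot> x)"
proof -
  interpret V: module rat_field A by (rule module_A)
  have "cohomology_class A k (c \<odot> y) = cohomology_class A k (c \<odot> x)"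
    if y: "y \<in> cohomology_class A k x" for y
  proof -
    obtain b where b: "b \<in> coboundaries A k" "y = b \<oplus> x" using mem_classD[OF y] by blast
    have "b \<in> carrier A" using b submodule.subset[OF coboundaries_submodule] by auto
    with b assms show ?thesis
      by (simp add: V.smult_r_distr class_coboundary_add coboundaries_smult smult_closed)
  qed
  with mem_class[OF assms]
  have "(\<Union>y\<in>cohomology_class A k x. cohomology_class A k (c \<odot> y)) =
      cohomology_class A k (c \<odot> x)" by blast
  then show ?thesis by (simp add: cohomology_def)
qed

lemma carrier_cohomology: "carrier (cohomology A k) = cohomology_class A k ` cocycles A k"
  and zero_cohomology: "\<zero>\<^bsub>cohomology A k\<^esub> = coboundaries A k"
  by (simp_all add: cohomology_def)

lemma class_closed: "z \<in> cocycles A k \<Longrightarrow> cohomology_class A k z \<in> carrier (cohomology A k)"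
  by (simp add: carrier_cohomology)

lemma cohomology_vectorspace: "vectorspace rat_field (cohomology A k)"
proof -
  interpret ring A by (rule is_ring)
  interpret V: vectorspace rat_field A by (rule vector_space)
  let ?H = "cohomology A k" and ?c = "cohomology_class A k"
  have zeroH: "\<zero>\<^bsub>?H\<^esub> = ?c \<zero>" by (simp add: zero_cohomology class_zero)
  note H = carrier_cohomology zeroH class_add class_smult cocycles_closed
  have "module rat_field ?H"
  proof (rule moduleI)
    show "cring rat_field" by (rule V.R.cring_axioms)
    show "abelian_group ?H"
    proof (rule abelian_groupI)
      fix x assume "x \<in> carrier ?H"
      then obtain z where z: "z \<in> cocycles A k" "x = ?c z" by (auto simp: H)
      then have "?c ((- 1) \<odot> z) \<oplus>\<^bsub>?H\<^esub> x = ?c (((- 1) \<odot> z) \<oplus> z)"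
        by (simp add: H smult_closed)
      also have "(- 1) \<odot> z \<oplus> z = \<zero>"
      proof -
        have "(- 1) \<odot> z \<oplus> z = (- 1 \<oplus>\<^bsub>rat_field\<^esub> 1) \<odot> z"
          using V.smult_l_distr[of "-1" 1 z] V.smult_one[of z] cocycles_closed[OF z(1)]
          by (simp add: rat_field_def)
        also have "\<dots> = 0 \<odot> z" by (simp add: rat_field_def)
        also have "\<dots> = \<zero>" using V.lmult_0[of z] z by (simp add: cocycles_closed)
        finally show ?thesis .
      qed
      finally show "\<exists>y\<in>carrier ?H. y \<oplus>\<^bsub>?H\<^esub> x = \<zero>\<^bsub>?H\<^esub>"
        using z cocycles_smult[of z k "-1"] by (auto simp: zero_cohomology class_zero class_closed)
    qed (auto simp: H cocycles_add zero_in_cocycles a_ac intro: arg_cong[where f = ?c])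
  next
    fix a b x assume "x \<in> carrier ?H"
    then obtain z where z: "z \<in> cocycles A k" "x = ?c z" by (auto simp: H)
    show "(a \<oplus>\<^bsub>rat_field\<^esub> b) \<odot>\<^bsub>?H\<^esub> x = a \<odot>\<^bsub>?H\<^esub> x \<oplus>\<^bsub>?H\<^esub> b \<odot>\<^bsub>?H\<^esub> x"
      using z V.smult_l_distr[of a b z] by (simp add: H smult_closed)
    show "a \<otimes>\<^bsub>rat_field\<^esub> b \<odot>\<^bsub>?H\<^esub> x = a \<odot>\<^bsub>?H\<^esub> (b \<odot>\<^bsub>?H\<^esub> x)"
      using z V.smult_assoc1[of a b z] by (simp add: H smult_closed)
    show "\<one>\<^bsub>rat_field\<^esub> \<odot>\<^bsub>?H\<^esub> x = x"
      using z V.smult_one[of z] by (simp add: H)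
    show "a \<odot>\<^bsub>?H\<^esub> x \<in> carrier ?H"
      using z by (simp add: class_smult class_closed cocycles_closed cocycles_smult)
    fix y assume "y \<in> carrier ?H"
    then obtain z' where z': "z' \<in> cocycles A k" "y = ?c z'" by (auto simp: H)
    show "a \<odot>\<^bsub>?H\<^esub> (x \<oplus>\<^bsub>?H\<^esub> y) = a \<odot>\<^bsub>?H\<^esub> x \<oplus>\<^bsub>?H\<^esub> a \<odot>\<^bsub>?H\<^esub> y"
      using z z' V.smult_r_distr[of a z z'] by (simp add: H smult_closed)
  qed
  then show ?thesis
    by (rule vectorspace.intro) (rule V.field_axioms)
qed

lemma cohomology_module: "module rat_field (cohomology A k)"
  using cohomology_vectorspace by (rule vectorspace.axioms)

lemma class_finsum:
  assumes "finite F" "\<And>y. y \<in> F \<Longrightarrow> z y \<in> cocycles A k"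
  shows "(\<Oplus>y\<in>F. z y) \<in> cocycles A k \<and> cohomology_class A k (\<Oplus>y\<in>F. z y) =
    (\<Oplus>\<^bsub>cohomology A k\<^esub>y\<in>F. cohomology_class A k (z y))"
  using assms
proof (induction F)
  interpret ring A by (rule is_ring)
  interpret H: module rat_field "cohomology A k" by (rule cohomology_module)
  case empty
  show ?case by (simp add: class_zero zero_cohomology zero_in_cocycles)
next
  interpret ring A by (rule is_ring)
  interpret H: module rat_field "cohomology A k" by (rule cohomology_module)
  case (insert x F)
  have "z \<in> F \<rightarrow> carrier A" "(\<lambda>y. cohomology_class A k (z y)) \<in> F \<rightarrow> carrier (cohomology A k)"
    using insert.prems by (auto intro: cocycles_closed class_closed)
  moreover have "z x \<in> cocycles A k" "z x \<in> carrier A"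
    "cohomology_class A k (z x) \<in> carrier (cohomology A k)"
    using insert.prems by (auto intro: cocycles_closed class_closed)
  moreover have "finsum A z F \<in> cocycles A k" "finsum A z F \<in> carrier A"
    "cohomology_class A k (finsum A z F) =
      (\<Oplus>\<^bsub>cohomology A k\<^esub>y\<in>F. cohomology_class A k (z y))"
    using insert by (auto intro: cocycles_closed)
  ultimately show ?case
    using insert.hyps
    by (simp add: finsum_insert H.finsum_insert class_add[symmetric] cocycles_add)
qed

text \<open>A basis of \<open>W\<close> is declared inside the space restricted to \<open>W\<close>.
  Span and independence are moved to the ambient cohomology, where bases of different subspaces can
  be compared.\<close>

lemma cohomology_basisD:
  assumes W: "submodule rat_field W (cohomology A k)" and "cohomology_basis A k W B"
  shows "B \<subseteq> W" "module.span rat_field (cohomology A k) B = W"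
    "\<not> module.lin_dep rat_field (cohomology A k) B"
proof -
  interpret H: vectorspace rat_field "cohomology A k" by (rule cohomology_vectorspace)
  have "vectorspace rat_field (cohomology A k\<lparr>carrier := W\<rparr>)"
    by (rule H.subspace_is_vs) (rule subspace.intro[OF cohomology_vectorspace W])
  from vectorspace.basis_def[OF this] assms(2)
  have "\<not> module.lin_dep rat_field (cohomology A k\<lparr>carrier := W\<rparr>) B"
    "module.span rat_field (cohomology A k\<lparr>carrier := W\<rparr>) B = W" and BW: "B \<subseteq> W"
    unfolding cohomology_basis_def by simp_all
  with H.span_li_not_depend[OF BW W]
  show "B \<subseteq> W" "module.span rat_field (cohomology A k) B = W"
    "\<not> module.lin_dep rat_field (cohomology A k) B"
    by simp_all
qed

lemma carrier_cohomology_submodule: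
  "submodule rat_field (carrier (cohomology A k)) (cohomology A k)"
proof -
  interpret H: module rat_field "cohomology A k" by (rule cohomology_module)
  show ?thesis by (rule submodule.intro[OF cohomology_module]) auto
qed

text \<open>Linear independence of classes, phrased for cocycles that sum to a coboundary. A y-step
  uses it with \<open>S\<close> empty and \<open>w\<close> exact; an x-step takes for
  \<open>S\<close> a basis of the old image and for \<open>w\<close> the image of an old
  cocycle.\<close>

lemma cohomology_independent:
  assumes indep: "\<not> module.lin_dep rat_field (cohomology A k)
      (S \<union> (\<lambda>y. cohomology_class A k (z y)) ` Y)"
    and S: "S \<subseteq> carrier (cohomology A k)" "S \<inter> (\<lambda>y. cohomology_class A k (z y)) ` Y = {}"
    and inj: "inj_on (\<lambda>y. cohomology_class A k (z y)) Y"
    and z: "\<And>y. y \<in> Y \<Longrightarrow> z y \<in> cocycles A k"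
    and w: "w \<in> cocycles A k" "cohomology_class A k w \<in> module.span rat_field (cohomology A k) S"
    and F: "finite F" "F \<subseteq> Y" and eq: "w \<oplus> (\<Oplus>y\<in>F. c y \<odot> z y) \<in> coboundaries A k"
    and y: "y \<in> F"
  shows "c y = 0"
proof -
  interpret H: module rat_field "cohomology A k" by (rule cohomology_module)
  interpret ring A by (rule is_ring)
  let ?H = "cohomology A k" and ?c = "cohomology_class A k"
  let ?z = "\<lambda>y. ?c (z y)"
  have injF: "inj_on ?z F" using inj F(2) by (rule inj_on_subset)
  \<comment> \<open>Coefficients indexed by generators become coefficients indexed by classes; this
    loses nothing because distinct elements of \<open>F\<close> have distinct classes.\<close>
  define d where "d = (\<lambda>v. c (inv_into F ?z v))"
  have d: "d (?z y) = c y" if "y \<in> F" for y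
    unfolding d_def using inv_into_f_f[OF injF that] by simp
  have cF: "c y \<odot> z y \<in> cocycles A k" if "y \<in> F" for y
    using that F z by (auto intro: cocycles_smult)
  have sum: "(\<Oplus>y\<in>F. c y \<odot> z y) \<in> cocycles A k"
    "?c (\<Oplus>y\<in>F. c y \<odot> z y) = (\<Oplus>\<^bsub>?H\<^esub>y\<in>F. ?c (c y \<odot> z y))"
    using class_finsum[OF F(1), of "\<lambda>y. c y \<odot> z y" k] cF by auto
  have wsum: "w \<oplus> (\<Oplus>y\<in>F. c y \<odot> z y) \<in> carrier A"
    using cocycles_closed[OF cocycles_add[OF w(1) sum(1)]] .
  have "?c (\<Oplus>y\<in>F. c y \<odot> z y) = (\<Oplus>\<^bsub>?H\<^esub>y\<in>F. ?c (c y \<odot> z y))"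
    by (rule sum(2))
  also have "\<dots> = (\<Oplus>\<^bsub>?H\<^esub>y\<in>F. d (?z y) \<odot>\<^bsub>?H\<^esub> ?z y)"
  proof (rule H.finsum_cong2[OF refl])
    fix y assume y: "y \<in> F"
    with F z have "z y \<in> carrier A" by (auto intro: cocycles_closed)
    with y d show "?c (c y \<odot> z y) = d (?z y) \<odot>\<^bsub>?H\<^esub> ?z y" by (simp add: class_smult)
  qed (use cF in \<open>auto simp: class_closed\<close>)
  also have "\<dots> = H.lincomb d (?z ` F)"
    unfolding H.lincomb_def
    by (rule H.finsum_reindex[symmetric]) (use injF F z in \<open>auto intro!: H.smult_closed simp: class_closed\<close>)
  finally have "?c w \<oplus>\<^bsub>?H\<^esub> H.lincomb d (?z ` F) = ?c (w \<oplus> (\<Oplus>y\<in>F. c y \<odot> z y))"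
    using class_add[OF cocycles_closed[OF w(1)] cocycles_closed[OF sum(1)], of k] by simp
  also have "\<dots> = \<zero>\<^bsub>?H\<^esub>"
    using eq wsum by (simp add: class_eq_zero_iff zero_cohomology)
  finally have "d (?z y) = \<zero>\<^bsub>rat_field\<^esub>"
    by (intro H.lin_indpt_disjoint_span[OF indep _ S(2), of "?z ` F" d "?c w"])
      (use S z F w y in \<open>auto simp: class_closed\<close>)
  with d y show ?thesis by simp
qed

end

section \<open>Maps induced on cohomology\<close>

locale diff_algebra_morphism =
  M: differential_algebra M + A: differential_algebra A
  for M :: "('m, 'e) diff_alg_scheme" and A :: "('a, 'f) diff_alg_scheme" +
  fixes \<phi> :: "'m \<Rightarrow> 'a"
  assumes morphism: "\<phi> \<in> diff_algebra_hom M A"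
begin

lemma hom_linear: "\<phi> \<in> module_hom rat_field M A"
  and hom_ring: "\<phi> \<in> ring_hom M A"
  and hom_grade: "x \<in> grade M n \<Longrightarrow> \<phi> x \<in> grade A n"
  and hom_dif: "x \<in> carrier M \<Longrightarrow> \<phi> (dif M x) = dif A (\<phi> x)"
  using morphism by (auto simp: diff_algebra_hom_def graded_algebra_hom_def)

lemma hom_mod_hom: "mod_hom rat_field M A \<phi>"
  by (intro mod_hom.intro mod_hom_axioms.intro M.module_A A.module_A hom_linear)

lemma hom_closed: "x \<in> carrier M \<Longrightarrow> \<phi> x \<in> carrier A"
  using hom_mod_hom by (rule mod_hom.f_im)

lemma hom_zero: "\<phi> \<zero>\<^bsub>M\<^esub> = \<zero>\<^bsub>A\<^esub>"
  using hom_mod_hom by (rule mod_hom.f0_is_0)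

lemma hom_add: "\<lbrakk>x \<in> carrier M; y \<in> carrier M\<rbrakk> \<Longrightarrow> \<phi> (x \<oplus>\<^bsub>M\<^esub> y) = \<phi> x \<oplus>\<^bsub>A\<^esub> \<phi> y"
  by (rule module_hom_add[OF hom_linear])

lemma hom_minus: "\<lbrakk>x \<in> carrier M; y \<in> carrier M\<rbrakk> \<Longrightarrow> \<phi> (x \<ominus>\<^bsub>M\<^esub> y) = \<phi> x \<ominus>\<^bsub>A\<^esub> \<phi> y"
  by (rule mod_hom.f_minus[OF hom_mod_hom])

lemma hom_smult: "x \<in> carrier M \<Longrightarrow> \<phi> (c \<odot>\<^bsub>M\<^esub> x) = c \<odot>\<^bsub>A\<^esub> \<phi> x"
  using module_hom_smult[OF hom_linear] by simp

lemma hom_finsum: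
  assumes "finite F" "g \<in> F \<rightarrow> carrier M"
  shows "\<phi> (\<Oplus>\<^bsub>M\<^esub>y\<in>F. g y) = (\<Oplus>\<^bsub>A\<^esub>y\<in>F. \<phi> (g y))"
  using assms
proof (induction F)
  interpret M: ring M by (rule M.is_ring)
  interpret A: ring A by (rule A.is_ring)
  case empty
  show ?case by (simp add: hom_zero)
next
  interpret M: ring M by (rule M.is_ring)
  interpret A: ring A by (rule A.is_ring)
  case (insert x F)
  then have "(\<lambda>y. \<phi> (g y)) \<in> F \<rightarrow> carrier A" "\<phi> (g x) \<in> carrier A"
    by (auto intro: hom_closed)
  with insert show ?case
    by (simp add: M.finsum_insert A.finsum_insert hom_add M.finsum_closed)
qed

lemma hom_cocycles: "z \<in> cocycles M k \<Longrightarrow> \<phi> z \<in> cocycles A k"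
  by (auto simp: cocycles_def hom_grade hom_dif[symmetric] M.grade_closed hom_zero)

lemma hom_coboundaries: "b \<in> coboundaries M k \<Longrightarrow> \<phi> b \<in> coboundaries A k"
  by (cases k) (auto simp: coboundaries_def hom_zero hom_dif hom_grade M.grade_closed)

lemma induced_map_class:
  assumes "z \<in> cocycles M k"
  shows "induced_map A \<phi> k (cohomology_class M k z) = cohomology_class A k (\<phi> z)"
proof -
  have z: "z \<in> carrier M" using assms by (rule M.cocycles_closed)
  have "cohomology_class A k (\<phi> y) = cohomology_class A k (\<phi> z)"
    if y: "y \<in> cohomology_class M k z" for y
  proof -
    obtain b where b: "b \<in> coboundaries M k" "y = b \<oplus>\<^bsub>M\<^esub> z" using M.mem_classD[OF y] by blast
    have "b \<in> carrier M" using b submodule.subset[OF M.coboundaries_submodule] by auto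
    with b z show ?thesis
      by (simp add: hom_add A.class_coboundary_add hom_coboundaries hom_closed)
  qed
  with M.mem_class[OF z] show ?thesis
    unfolding induced_map_def by blast
qed

text \<open>Differences of cocycles are cocycles, so injectivity reduces to triviality of the
  kernel. Later injectivity arguments can then handle cocycles instead of cosets.\<close>

lemma induced_injective_iff:
  "induced_injective M A \<phi> k \<longleftrightarrow>
    (\<forall>z\<in>cocycles M k. \<phi> z \<in> coboundaries A k \<longrightarrow> z \<in> coboundaries M k)" (is "_ \<longleftrightarrow> ?R")
proof -
  interpret MR: ring M by (rule M.is_ring)
  interpret Z: submodule rat_field "cocycles M k" M by (rule M.cocycles_submodule)
  have minus: "x \<ominus>\<^bsub>M\<^esub> y \<in> cocycles M k" if "x \<in> cocycles M k" "y \<in> cocycles M k" for x y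
  proof -
    have "\<ominus>\<^bsub>M\<^esub> y \<in> cocycles M k"
      using M.cocycles_smult[OF that(2)] module.smult_minus_1[OF M.module_A M.cocycles_closed[OF that(2)]]
      by metis
    with that show ?thesis unfolding a_minus_def by (intro M.cocycles_add)
  qed
  show ?thesis
  proof
    assume inj: "induced_injective M A \<phi> k"
    show ?R
    proof (intro ballI impI)
      fix z assume z: "z \<in> cocycles M k" "\<phi> z \<in> coboundaries A k"
      then have "induced_map A \<phi> k (cohomology_class M k z) =
        induced_map A \<phi> k (cohomology_class M k \<zero>\<^bsub>M\<^esub>)"
        using A.class_eq_zero_iff[of "\<phi> z" k]
        by (simp add: induced_map_class M.zero_in_cocycles hom_zero A.class_zero
            hom_closed M.cocycles_closed)
      with inj z have "cohomology_class M k z = cohomology_class M k \<zero>\<^bsub>M\<^esub>"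
        using M.class_closed M.zero_in_cocycles unfolding induced_injective_def inj_on_def by blast
      with z show "z \<in> coboundaries M k"
        by (simp add: M.class_zero M.class_eq_zero_iff M.cocycles_closed)
    qed
  next
    assume R: ?R
    show "induced_injective M A \<phi> k"
      unfolding induced_injective_def
    proof (rule inj_onI)
      fix C D assume C: "C \<in> carrier (cohomology M k)" "D \<in> carrier (cohomology M k)"
        and eq: "induced_map A \<phi> k C = induced_map A \<phi> k D"
      then obtain x y where xy: "x \<in> cocycles M k" "C = cohomology_class M k x"
        "y \<in> cocycles M k" "D = cohomology_class M k y"
        by (auto simp: M.carrier_cohomology)
      with eq have "\<phi> (x \<ominus>\<^bsub>M\<^esub> y) \<in> coboundaries A k"
        by (simp add: induced_map_class A.class_eq_iff hom_closed M.cocycles_closed hom_minus)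
      with R minus xy have "x \<ominus>\<^bsub>M\<^esub> y \<in> coboundaries M k" by blast
      with xy show "C = D" by (simp add: M.class_eq_iff M.cocycles_closed)
    qed
  qed
qed

lemma induced_image_eq:
  "induced_image M A \<phi> k = (\<lambda>z. cohomology_class A k (\<phi> z)) ` cocycles M k"
  by (simp add: induced_image_def M.carrier_cohomology image_image induced_map_class)

lemma induced_image_submodule:
  "submodule rat_field (induced_image M A \<phi> k) (cohomology A k)"
proof (rule submodule.intro[OF A.cohomology_module])
  show "\<zero>\<^bsub>cohomology A k\<^esub> \<in> induced_image M A \<phi> k"
    unfolding induced_image_eq A.zero_cohomology
    using M.zero_in_cocycles by (metis A.class_zero hom_zero image_eqI)
next
  fix c v assume "v \<in> induced_image M A \<phi> k"
  then obtain z where "z \<in> cocycles M k" "v = cohomology_class A k (\<phi> z)"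
    by (auto simp: induced_image_eq)
  then show "c \<odot>\<^bsub>cohomology A k\<^esub> v \<in> induced_image M A \<phi> k"
    unfolding induced_image_eq
    by (intro image_eqI[of _ _ "c \<odot>\<^bsub>M\<^esub> z"])
      (auto simp: A.class_smult hom_closed M.cocycles_closed hom_smult M.cocycles_smult)
next
  fix v w assume "v \<in> induced_image M A \<phi> k" "w \<in> induced_image M A \<phi> k"
  then obtain z y where "z \<in> cocycles M k" "v = cohomology_class A k (\<phi> z)"
    "y \<in> cocycles M k" "w = cohomology_class A k (\<phi> y)"
    by (auto simp: induced_image_eq)
  then show "v \<oplus>\<^bsub>cohomology A k\<^esub> w \<in> induced_image M A \<phi> k"
    unfolding induced_image_eq
    by (intro image_eqI[of _ _ "z \<oplus>\<^bsub>M\<^esub> y"])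
      (auto simp: A.class_add hom_closed M.cocycles_closed hom_add M.cocycles_add)
qed (auto simp: induced_image_eq A.class_closed hom_cocycles)

lemma induced_ker_eq:
  "induced_ker M A \<phi> k =
    cohomology_class M k ` {z \<in> cocycles M k. \<phi> z \<in> coboundaries A k}"
proof -
  have "induced_map A \<phi> k (cohomology_class M k z) = \<zero>\<^bsub>cohomology A k\<^esub> \<longleftrightarrow>
      \<phi> z \<in> coboundaries A k" if "z \<in> cocycles M k" for z
    using that
    by (simp add: induced_map_class A.zero_cohomology A.class_eq_zero_iff hom_closed M.cocycles_closed)
  then show ?thesis
    unfolding induced_ker_def M.carrier_cohomology by blast
qed

lemma induced_ker_submodule:
  "submodule rat_field (induced_ker M A \<phi> k) (cohomology M k)"
proof (rule submodule.intro[OF M.cohomology_module])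
  show "\<zero>\<^bsub>cohomology M k\<^esub> \<in> induced_ker M A \<phi> k"
    unfolding induced_ker_eq M.zero_cohomology
    by (rule image_eqI[where x = "\<zero>\<^bsub>M\<^esub>"])
      (simp_all add: M.class_zero M.zero_in_cocycles hom_zero A.zero_in_coboundaries)
next
  fix c v assume "v \<in> induced_ker M A \<phi> k"
  then obtain z where "z \<in> cocycles M k" "\<phi> z \<in> coboundaries A k" "v = cohomology_class M k z"
    by (auto simp: induced_ker_eq)
  then show "c \<odot>\<^bsub>cohomology M k\<^esub> v \<in> induced_ker M A \<phi> k"
    unfolding induced_ker_eq
    by (intro image_eqI[of _ _ "c \<odot>\<^bsub>M\<^esub> z"])
      (auto simp: M.class_smult M.cocycles_closed hom_smult M.cocycles_smult A.coboundaries_smult)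
next
  fix v w assume "v \<in> induced_ker M A \<phi> k" "w \<in> induced_ker M A \<phi> k"
  then obtain z y where "z \<in> cocycles M k" "\<phi> z \<in> coboundaries A k" "v = cohomology_class M k z"
    "y \<in> cocycles M k" "\<phi> y \<in> coboundaries A k" "w = cohomology_class M k y"
    by (auto simp: induced_ker_eq)
  then show "v \<oplus>\<^bsub>cohomology M k\<^esub> w \<in> induced_ker M A \<phi> k"
    unfolding induced_ker_eq
    by (intro image_eqI[of _ _ "z \<oplus>\<^bsub>M\<^esub> y"])
      (auto simp: M.class_add M.cocycles_closed hom_add M.cocycles_add A.coboundaries_add)
qed (auto simp: induced_ker_eq M.class_closed)

end

section \<open>Adjoining generators\<close>

text \<open>The old algebra is a subset of the new one, embedded by the identity, so the operations
  of \<open>M'\<close> restrict to those of \<open>M\<close> on \<open>carrier M\<close>. Agreement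
  of the two degree functions on \<open>G\<close> is not assumed but derived in
  \<open>deg_eq\<close>.\<close>

locale generator_extension =
  I: diff_algebra_morphism M M' "\<lambda>m. m" +
  V: free_evaluation M deg G E + V': free_evaluation M' deg' "G \<union> Y" E'
  for M M' :: "'m diff_alg" and deg deg' :: "'m \<Rightarrow> nat" and G Y :: "'m set" and E E' +
  fixes n :: nat
  assumes Y_disjoint: "Y \<inter> G = {}" and deg_Y: "y \<in> Y \<Longrightarrow> deg' y = n"
begin

lemma zero_eq: "\<zero>\<^bsub>M'\<^esub> = \<zero>\<^bsub>M\<^esub>"
  using I.hom_zero by simp

lemma dif_eq: "x \<in> carrier M \<Longrightarrow> dif M' x = dif M x"
  using I.hom_dif by simp

lemma add_eq: "\<lbrakk>x \<in> carrier M; y \<in> carrier M\<rbrakk> \<Longrightarrow> x \<oplus>\<^bsub>M'\<^esub> y = x \<oplus>\<^bsub>M\<^esub> y"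
  using I.hom_add by simp

lemma mult_eq: "\<lbrakk>x \<in> carrier M; y \<in> carrier M\<rbrakk> \<Longrightarrow> x \<otimes>\<^bsub>M'\<^esub> y = x \<otimes>\<^bsub>M\<^esub> y"
  using ring_hom_mult[OF I.hom_ring] by simp

lemma smult_eq: "x \<in> carrier M \<Longrightarrow> c \<odot>\<^bsub>M'\<^esub> x = c \<odot>\<^bsub>M\<^esub> x"
  using I.hom_smult by simp

lemma one_eq: "\<one>\<^bsub>M'\<^esub> = \<one>\<^bsub>M\<^esub>"
  using ring_hom_one[OF I.hom_ring] by simp

text \<open>The same nonzero element is homogeneous of both degrees in \<open>M'\<close>: of
  \<open>deg' x\<close> as a generator of \<open>M'\<close>, and of \<open>deg x\<close> because the
  inclusion preserves degrees.\<close>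

lemma deg_eq: assumes "x \<in> G" shows "deg' x = deg x"
proof (rule I.A.grade_unique)
  show "x \<in> grade M' (deg' x)" using V'.gen_grade assms by blast
  show "x \<in> grade M' (deg x)" using V.gen_grade[OF assms] by (rule I.hom_grade)
  show "x \<noteq> \<zero>\<^bsub>M'\<^esub>" using V.gen_nonzero[OF assms] by (simp add: zero_eq)
qed

lemma poly_mono: "p \<in> carrier (tensor_algebra G) \<Longrightarrow> p \<in> carrier (tensor_algebra (G \<union> Y))"
  by (auto simp: carrier_tensor_algebra)

text \<open>A polynomial in old letters is evaluated by sums and products of elements of
  \<open>M\<close>, and on these the two algebras agree. Together with the counting of letters this
  places low-degree elements of \<open>M'\<close> back in \<open>M\<close>.\<close>

lemma E_eq: "p \<in> carrier (tensor_algebra G) \<Longrightarrow> E' p = E p"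
proof -
  have word: "E' (word_poly w) = E (word_poly w)" if "w \<in> lists G" for w
    using that
  proof (induction w)
    case Nil
    show ?case by (simp add: V.E_one V'.E_one one_eq)
  next
    case (Cons x w)
    then have "E' (word_poly (x # w)) = x \<otimes>\<^bsub>M'\<^esub> E (word_poly w)"
      by (subst V'.E_Cons) auto
    also have "\<dots> = x \<otimes>\<^bsub>M\<^esub> E (word_poly w)"
      using Cons by (intro mult_eq V.gen_closed V.E_closed word_poly_closed) auto
    finally show ?case using Cons by (simp add: V.E_Cons)
  qed
  assume p: "p \<in> carrier (tensor_algebra G)"
  then have "{w. p w \<noteq> 0} \<subseteq> UNIV" by simp
  with p show ?thesis
  proof (induction rule: tensor_algebra_induct)
    case zero
    show ?case by (simp add: V.E_zero V'.E_zero zero_eq)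
  next
    case (add c w p)
    have w: "w \<in> lists (G \<union> Y)" using add by auto
    have c: "E (word_poly w) \<in> carrier M" "E p \<in> carrier M"
      using add by (auto intro: V.E_closed word_poly_closed)
    have "E' (\<lambda>v. c * word_poly w v + p v) = c \<odot>\<^bsub>M'\<^esub> E (word_poly w) \<oplus>\<^bsub>M'\<^esub> E p"
      using add w by (simp add: V'.E_monomial_add poly_mono word del: in_lists_conv_set)
    also have "\<dots> = c \<odot>\<^bsub>M\<^esub> E (word_poly w) \<oplus>\<^bsub>M\<^esub> E p"
      using c by (simp add: smult_eq add_eq I.M.smult_closed)
    finally show ?case using add by (simp add: V.E_monomial_add del: in_lists_conv_set)
  qed
qed

lemma E_grade_old:
  assumes p: "p \<in> carrier (tensor_algebra G)" "\<forall>w. p w \<noteq> 0 \<longrightarrow> sum_list (map deg' w) = j"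
  shows "E' p \<in> grade M j"
proof -
  have "sum_list (map deg w) = j" if "p w \<noteq> 0" for w
  proof -
    have "w \<in> lists G" using p that by (auto simp: carrier_tensor_algebra)
    then have "map deg' w = map deg w" using deg_eq by auto
    with p that show ?thesis by metis
  qed
  with p V.E_grade show ?thesis by (simp add: E_eq)
qed

lemma grade_below: assumes "j < n" shows "grade M' j = grade M j"
proof
  show "grade M j \<subseteq> grade M' j" using I.hom_grade by auto
  show "grade M' j \<subseteq> grade M j"
  proof
    fix x assume "x \<in> grade M' j"
    then obtain p where p: "p \<in> carrier (tensor_algebra (G \<union> Y))"
      "\<forall>w. p w \<noteq> 0 \<longrightarrow> sum_list (map deg' w) = j" "E' p = x" by (rule V'.grade_eval)
    have "p \<in> carrier (tensor_algebra G)"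
      using p(1,2) by (rule V'.poly_below_degree) (use assms deg_Y in auto)
    from E_grade_old[OF this p(2)] p(3) show "x \<in> grade M j" by simp
  qed
qed

lemma grade_at:
  assumes "x \<in> grade M' n"
  obtains m F c where "m \<in> grade M n" "finite F" "F \<subseteq> Y"
    "x = m \<oplus>\<^bsub>M'\<^esub> (\<Oplus>\<^bsub>M'\<^esub>y\<in>F. c y \<odot>\<^bsub>M'\<^esub> y)"
proof -
  obtain p where p: "p \<in> carrier (tensor_algebra (G \<union> Y))"
      "\<forall>w. p w \<noteq> 0 \<longrightarrow> sum_list (map deg' w) = n" "E' p = x"
    using assms by (rule V'.grade_eval)
  have "deg' y = n" if "y \<in> G \<union> Y - G" for y using that deg_Y by auto
  from V'.poly_at_degree[OF p(1,2) this] obtain q F c where q: "q \<in> carrier (tensor_algebra G)"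
    "\<forall>w. q w \<noteq> 0 \<longrightarrow> sum_list (map deg' w) = n" "finite F" "F \<subseteq> G \<union> Y - G"
    "E' p = E' q \<oplus>\<^bsub>M'\<^esub> (\<Oplus>\<^bsub>M'\<^esub>y\<in>F. c y \<odot>\<^bsub>M'\<^esub> y)"
    by blast
  show thesis
    by (rule that[OF E_grade_old[OF q(1,2)] q(3)]) (use p q in auto)
qed

lemma cocycles_below: "j < n \<Longrightarrow> cocycles M' j = cocycles M j"
  by (auto simp: cocycles_def grade_below zero_eq dif_eq I.M.grade_closed)

lemma cocycles_mono: "cocycles M j \<subseteq> cocycles M' j"
  using I.hom_cocycles by auto

text \<open>The case \<open>j = n\<close> is included: coboundaries of degree \<open>n\<close> are
  differentials of elements of degree \<open>n - 1\<close>, below the new generators.\<close>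

lemma coboundaries_upto: "j \<le> n \<Longrightarrow> coboundaries M' j = coboundaries M j"
  by (cases j) (auto simp: coboundaries_def zero_eq grade_below dif_eq I.M.grade_closed image_iff)

lemma dif_grade_at:
  assumes m: "m \<in> grade M n" and F: "finite F" "F \<subseteq> Y"
  shows "dif M' (m \<oplus>\<^bsub>M'\<^esub> (\<Oplus>\<^bsub>M'\<^esub>y\<in>F. c y \<odot>\<^bsub>M'\<^esub> y)) =
    dif M m \<oplus>\<^bsub>M'\<^esub> (\<Oplus>\<^bsub>M'\<^esub>y\<in>F. c y \<odot>\<^bsub>M'\<^esub> dif M' y)"
proof -
  interpret R': ring M' by (rule I.A.is_ring)
  have Y: "y \<in> carrier M'" if "y \<in> F" for y using that F V'.gen_closed by auto
  have c: "(\<lambda>y. c y \<odot>\<^bsub>M'\<^esub> y) \<in> F \<rightarrow> carrier M'" using Y I.A.smult_closed by auto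
  have "(\<Oplus>\<^bsub>M'\<^esub>y\<in>F. c y \<odot>\<^bsub>M'\<^esub> y) \<in> carrier M' \<and>
    dif M' (\<Oplus>\<^bsub>M'\<^esub>y\<in>F. c y \<odot>\<^bsub>M'\<^esub> y) = (\<Oplus>\<^bsub>M'\<^esub>y\<in>F. c y \<odot>\<^bsub>M'\<^esub> dif M' y)"
    using F(1) Y
  proof (induction F)
    case empty
    show ?case by (simp add: I.A.dif_zero)
  next
    case (insert x F)
    have d: "dif M' y \<in> carrier M'" if "y \<in> carrier M'" for y
      using module_hom_closed[OF I.A.dif_linear] that by auto
    have "x \<in> carrier M'" "(\<lambda>y. c y \<odot>\<^bsub>M'\<^esub> y) \<in> F \<rightarrow> carrier M'"
      "(\<lambda>y. c y \<odot>\<^bsub>M'\<^esub> dif M' y) \<in> F \<rightarrow> carrier M'"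
      using insert.prems by (auto intro!: I.A.smult_closed d)
    with insert show ?case
      by (simp add: R'.finsum_insert I.A.smult_closed I.A.dif_add I.A.dif_smult d)
  qed
  then show ?thesis
    using m by (simp add: I.A.dif_add dif_eq I.M.grade_closed I.hom_closed)
qed

text \<open>For \<open>x = m + sum of c y * y\<close>, closedness says that \<open>dm\<close> and
  the combination of the \<open>z y\<close> cancel. As \<open>dm\<close> is exact in
  \<open>M\<close>, this is a linear relation among the independent classes of the
  \<open>z y\<close>, so every \<open>c y\<close> vanishes and \<open>x = m\<close>.\<close>

lemma cocycles_at_independent:
  assumes z: "\<And>y. y \<in> Y \<Longrightarrow> dif M' y = z y" "\<And>y. y \<in> Y \<Longrightarrow> z y \<in> cocycles M (Suc n)"
    and inj: "inj_on (\<lambda>y. cohomology_class M (Suc n) (z y)) Y"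
    and indep: "\<not> module.lin_dep rat_field (cohomology M (Suc n))
      ((\<lambda>y. cohomology_class M (Suc n) (z y)) ` Y)"
  shows "cocycles M' n = cocycles M n"
proof
  interpret R: ring M by (rule I.M.is_ring)
  interpret R': ring M' by (rule I.A.is_ring)
  interpret H: module rat_field "cohomology M (Suc n)" by (rule I.M.cohomology_module)
  show "cocycles M' n \<subseteq> cocycles M n"
  proof
    fix x assume x: "x \<in> cocycles M' n"
    then have "x \<in> grade M' n" by (simp add: cocycles_def)
    then obtain m F c where m: "m \<in> grade M n" and F: "finite F" "F \<subseteq> Y"
      and xeq: "x = m \<oplus>\<^bsub>M'\<^esub> (\<Oplus>\<^bsub>M'\<^esub>y\<in>F. c y \<odot>\<^bsub>M'\<^esub> y)" by (rule grade_at)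
    have zF: "dif M' y = z y" if "y \<in> F" for y using that F z(1) by blast
    have zc: "z y \<in> carrier M" if "y \<in> F" for y using that F z I.M.cocycles_closed by blast
    have dm: "dif M m \<in> carrier M" using I.M.dif_grade[OF m] by (rule I.M.grade_closed)
    have cz: "(\<lambda>y. c y \<odot>\<^bsub>M\<^esub> z y) \<in> F \<rightarrow> carrier M" using zc by (auto intro: I.M.smult_closed)
    have "(\<Oplus>\<^bsub>M'\<^esub>y\<in>F. c y \<odot>\<^bsub>M'\<^esub> dif M' y) = (\<Oplus>\<^bsub>M'\<^esub>y\<in>F. c y \<odot>\<^bsub>M\<^esub> z y)"
      by (rule R'.finsum_cong2[OF refl])
        (use zF zc I.hom_closed in \<open>auto simp: smult_eq I.M.smult_closed\<close>)
    also have "\<dots> = (\<Oplus>\<^bsub>M\<^esub>y\<in>F. c y \<odot>\<^bsub>M\<^esub> z y)"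
      using I.hom_finsum[OF F(1) cz] by simp
    finally have "dif M m \<oplus>\<^bsub>M\<^esub> (\<Oplus>\<^bsub>M\<^esub>y\<in>F. c y \<odot>\<^bsub>M\<^esub> z y) = \<zero>\<^bsub>M\<^esub>"
      using dif_grade_at[OF m F, of c] x xeq R.finsum_closed[OF cz] dm
      by (simp add: cocycles_def zero_eq add_eq)
    then have eq: "dif M m \<oplus>\<^bsub>M\<^esub> (\<Oplus>\<^bsub>M\<^esub>y\<in>F. c y \<odot>\<^bsub>M\<^esub> z y) \<in> coboundaries M (Suc n)"
      by (simp add: I.M.zero_in_coboundaries)
    have w: "dif M m \<in> cocycles M (Suc n)"
      using I.M.dif_grade[OF m] I.M.dif_dif[OF I.M.grade_closed[OF m]] by (simp add: cocycles_def)
    have "dif M m \<in> coboundaries M (Suc n)" using m by (simp add: coboundaries_def)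
    \<comment> \<open>The class of \<open>dm\<close> is zero, hence lies in the span of the empty
      set: this is the independence lemma with \<open>S\<close> empty.\<close>
    then have span: "cohomology_class M (Suc n) (dif M m) \<in> H.span {}"
      using I.M.class_eq_zero_iff[OF dm, of "Suc n"] H.span_is_submodule[of "{}"]
      by (simp add: I.M.zero_cohomology[symmetric] submodule.zero_closed)
    have c0: "c y = 0" if "y \<in> F" for y
      by (rule I.M.cohomology_independent[of "Suc n" "{}" z Y "dif M m" F c y])
        (use indep inj z w span F eq that in auto)
    have "(\<Oplus>\<^bsub>M'\<^esub>y\<in>F. c y \<odot>\<^bsub>M'\<^esub> y) = (\<Oplus>\<^bsub>M'\<^esub>y\<in>F. \<zero>\<^bsub>M'\<^esub>)"
      by (rule R'.finsum_cong2[OF refl])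
        (use c0 F V'.gen_closed module.lmult_0[OF I.A.module_A] in auto)
    then have "x = m" using xeq m by (simp add: I.hom_closed I.M.grade_closed)
    with m x show "x \<in> cocycles M n"
      by (simp add: cocycles_def zero_eq dif_eq I.M.grade_closed)
  qed
qed (rule cocycles_mono)

end

section \<open>Cohomology isomorphisms across an extension\<close>

definition cohomology_iso ::
  "('m, 'e) diff_alg_scheme \<Rightarrow> ('a, 'f) diff_alg_scheme \<Rightarrow> ('m \<Rightarrow> 'a) \<Rightarrow> nat \<Rightarrow> bool" where
  "cohomology_iso M A \<phi> j \<longleftrightarrow>
    induced_injective M A \<phi> j \<and> induced_image M A \<phi> j = carrier (cohomology A j)"

lemma (in diff_algebra_morphism) cohomology_isoI:
  assumes "\<And>z. \<lbrakk>z \<in> cocycles M j; \<phi> z \<in> coboundaries A j\<rbrakk> \<Longrightarrow> z \<in> coboundaries M j"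
    and "carrier (cohomology A j) \<subseteq> induced_image M A \<phi> j"
  shows "cohomology_iso M A \<phi> j"
  using assms submodule.subset[OF induced_image_submodule, of j]
  unfolding cohomology_iso_def induced_injective_iff by blast

locale generator_extension_over = generator_extension M M' deg deg' G Y E E' n +
  \<phi>: diff_algebra_morphism M A \<phi> + \<phi>': diff_algebra_morphism M' A \<phi>'
  for M M' :: "'m diff_alg" and deg deg' :: "'m \<Rightarrow> nat" and G Y :: "'m set" and E E'
    and n :: nat and A :: "'a diff_alg" and \<phi> \<phi>' :: "'m \<Rightarrow> 'a" +
  assumes extends: "m \<in> carrier M \<Longrightarrow> \<phi>' m = \<phi> m"
begin

lemma cohomology_iso_transfer:
  assumes "cocycles M' j = cocycles M j" "coboundaries M' j = coboundaries M j"
    and "cohomology_iso M A \<phi> j"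
  shows "cohomology_iso M' A \<phi>' j"
proof (rule \<phi>'.cohomology_isoI)
  have eq: "\<phi>' z = \<phi> z" if "z \<in> cocycles M j" for z
    using that by (simp add: extends I.M.cocycles_closed)
  show "z \<in> coboundaries M' j" if "z \<in> cocycles M' j" "\<phi>' z \<in> coboundaries A j" for z
    using that assms eq unfolding cohomology_iso_def \<phi>.induced_injective_iff by auto
  show "carrier (cohomology A j) \<subseteq> induced_image M' A \<phi>' j"
    using assms eq unfolding cohomology_iso_def \<phi>.induced_image_eq \<phi>'.induced_image_eq by auto
qed

lemma cohomology_iso_below:
  "j < n \<Longrightarrow> cohomology_iso M A \<phi> j \<Longrightarrow> cohomology_iso M' A \<phi>' j"
  by (rule cohomology_iso_transfer) (simp_all add: cocycles_below coboundaries_upto)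

text \<open>Surjectivity: the old image contributes \<open>B\<close>, the new generators contribute
  the completing classes, and together these span. Injectivity: if the image of
  \<open>m + sum of c y * y\<close> is exact, independence of the completed basis removes the new
  generators and leaves an old cocycle.\<close>

lemma cohomology_iso_at:
  assumes closed: "\<And>x. x \<in> Y \<Longrightarrow> dif M' x = \<zero>\<^bsub>M\<^esub>"
    and a: "\<And>x. x \<in> Y \<Longrightarrow> \<phi>' x = a x" "\<And>x. x \<in> Y \<Longrightarrow> a x \<in> cocycles A n"
    and inj: "inj_on (\<lambda>x. cohomology_class A n (a x)) Y"
    and B: "cohomology_basis A n (induced_image M A \<phi> n) B"
      "B \<inter> (\<lambda>x. cohomology_class A n (a x)) ` Y = {}"
    and basis: "cohomology_basis A n (carrier (cohomology A n))
      (B \<union> (\<lambda>x. cohomology_class A n (a x)) ` Y)"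
    and mono: "induced_injective M A \<phi> n"
  shows "cohomology_iso M' A \<phi>' n"
proof (rule \<phi>'.cohomology_isoI)
  interpret R': ring M' by (rule I.A.is_ring)
  interpret RA: ring A by (rule \<phi>.A.is_ring)
  interpret H: module rat_field "cohomology A n" by (rule \<phi>.A.cohomology_module)
  let ?C = "(\<lambda>x. cohomology_class A n (a x)) ` Y"
  note B' = \<phi>.A.cohomology_basisD[OF \<phi>.induced_image_submodule B(1)]
  note basis' = \<phi>.A.cohomology_basisD[OF \<phi>.A.carrier_cohomology_submodule basis]
  have Yc: "x \<in> carrier M'" if "x \<in> Y" for x using V'.gen_closed that by auto
  show "carrier (cohomology A n) \<subseteq> induced_image M' A \<phi>' n"
  proof -
    have "B \<subseteq> induced_image M' A \<phi>' n"
    proof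
      fix v assume "v \<in> B"
      then obtain z where "z \<in> cocycles M n" "v = cohomology_class A n (\<phi> z)"
        using B' by (auto simp: \<phi>.induced_image_eq)
      then show "v \<in> induced_image M' A \<phi>' n"
        unfolding \<phi>'.induced_image_eq using cocycles_mono
        by (intro image_eqI[of _ _ z]) (auto simp: extends I.M.cocycles_closed)
    qed
    moreover have "?C \<subseteq> induced_image M' A \<phi>' n"
    proof clarify
      fix x assume x: "x \<in> Y"
      have "x \<in> grade M' n" using V'.gen_grade[of x] x deg_Y by auto
      then have "x \<in> cocycles M' n" using closed x by (simp add: cocycles_def zero_eq)
      then show "cohomology_class A n (a x) \<in> induced_image M' A \<phi>' n"
        unfolding \<phi>'.induced_image_eq using a x by (intro image_eqI[of _ _ x]) auto
    qed
    ultimately show ?thesis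
      using H.span_is_subset[OF _ \<phi>'.induced_image_submodule] basis'(2) by (metis le_sup_iff)
  qed
  fix x assume x: "x \<in> cocycles M' n" "\<phi>' x \<in> coboundaries A n"
  then have "x \<in> grade M' n" by (simp add: cocycles_def)
  then obtain m F c where m: "m \<in> grade M n" and F: "finite F" "F \<subseteq> Y"
    and xeq: "x = m \<oplus>\<^bsub>M'\<^esub> (\<Oplus>\<^bsub>M'\<^esub>y\<in>F. c y \<odot>\<^bsub>M'\<^esub> y)" by (rule grade_at)
  have mc: "m \<in> carrier M" "m \<in> carrier M'"
    using m by (auto simp: I.M.grade_closed I.hom_closed)
  have Fc: "(\<lambda>y. c y \<odot>\<^bsub>M'\<^esub> y) \<in> F \<rightarrow> carrier M'"
    using F Yc by (auto intro!: I.A.smult_closed)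
  have "(\<Oplus>\<^bsub>M'\<^esub>y\<in>F. c y \<odot>\<^bsub>M'\<^esub> dif M' y) = (\<Oplus>\<^bsub>M'\<^esub>y\<in>F. \<zero>\<^bsub>M'\<^esub>)"
  proof (rule R'.finsum_cong'[OF refl])
    fix y assume "y \<in> F"
    then have "dif M' y = \<zero>\<^bsub>M'\<^esub>" using F closed by (auto simp: zero_eq)
    then show "c y \<odot>\<^bsub>M'\<^esub> dif M' y = \<zero>\<^bsub>M'\<^esub>"
      using module.smult_r_null[OF I.A.module_A] by simp
  qed simp
  moreover have "dif M m \<in> carrier M'"
    using I.M.dif_grade[OF m] by (auto dest: I.M.grade_closed intro: I.hom_closed)
  \<comment> \<open>The new generators are closed, so \<open>dx = dm\<close> and the old part
    \<open>m\<close> is itself a cocycle.\<close>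
  ultimately have "dif M m = \<zero>\<^bsub>M\<^esub>"
    using dif_grade_at[OF m F, of c] x(1) xeq
    by (simp add: cocycles_def) (simp add: zero_eq)
  with m have mz: "m \<in> cocycles M n" by (simp add: cocycles_def)
  have "(\<Oplus>\<^bsub>A\<^esub>y\<in>F. \<phi>' (c y \<odot>\<^bsub>M'\<^esub> y)) = (\<Oplus>\<^bsub>A\<^esub>y\<in>F. c y \<odot>\<^bsub>A\<^esub> a y)"
  proof (rule RA.finsum_cong'[OF refl])
    fix y assume "y \<in> F"
    then show "\<phi>' (c y \<odot>\<^bsub>M'\<^esub> y) = c y \<odot>\<^bsub>A\<^esub> a y"
      using F Yc a by (auto simp: \<phi>'.hom_smult)
  next
    have "a y \<in> carrier A" if "y \<in> F" for y using that F a \<phi>.A.cocycles_closed by blast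
    then show "(\<lambda>y. c y \<odot>\<^bsub>A\<^esub> a y) \<in> F \<rightarrow> carrier A" by (auto intro: \<phi>.A.smult_closed)
  qed
  then have "\<phi>' x = \<phi> m \<oplus>\<^bsub>A\<^esub> (\<Oplus>\<^bsub>A\<^esub>y\<in>F. c y \<odot>\<^bsub>A\<^esub> a y)"
    using \<phi>'.hom_add[OF mc(2) R'.finsum_closed[OF Fc]] \<phi>'.hom_finsum[OF F(1) Fc] xeq extends[OF mc(1)]
    by simp
  with x have eq: "\<phi> m \<oplus>\<^bsub>A\<^esub> (\<Oplus>\<^bsub>A\<^esub>y\<in>F. c y \<odot>\<^bsub>A\<^esub> a y) \<in> coboundaries A n" by simp
  have w: "\<phi> m \<in> cocycles A n" using mz by (rule \<phi>.hom_cocycles)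
  \<comment> \<open>The class of \<open>\<phi> m\<close> belongs to the old image, which
    \<open>B\<close> spans; it cannot cancel a nontrivial combination of the completing
    classes.\<close>
  have span: "cohomology_class A n (\<phi> m) \<in> H.span B"
    using mz B'(2) by (auto simp: \<phi>.induced_image_eq)
  have BH: "B \<subseteq> carrier (cohomology A n)" using basis'(1) by auto
  have c0: "c y = 0" if "y \<in> F" for y
    using \<phi>.A.cohomology_independent[OF basis'(3) BH B(2) inj a(2) w span F eq that] by simp
  have "(\<Oplus>\<^bsub>M'\<^esub>y\<in>F. c y \<odot>\<^bsub>M'\<^esub> y) = (\<Oplus>\<^bsub>M'\<^esub>y\<in>F. \<zero>\<^bsub>M'\<^esub>)"
    by (rule R'.finsum_cong'[OF refl])
      (use c0 F Yc module.lmult_0[OF I.A.module_A] in auto)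
  then have "x = m" using xeq mc by simp
  \<comment> \<open>Injectivity for \<open>M\<close> makes \<open>m\<close> exact in
    \<open>M\<close>, and the coboundaries of degree \<open>n\<close> are the same in
    \<open>M'\<close>.\<close>
  with mono mz x(2) mc show "x \<in> coboundaries M' n"
    by (simp add: \<phi>.induced_injective_iff extends coboundaries_upto)
qed

end

section \<open>Well-ordering the generators\<close>

definition ordered_generators ::
  "('m, 'e) diff_alg_scheme \<Rightarrow> ('m \<Rightarrow> nat) \<Rightarrow> 'm set \<Rightarrow> ('m \<times> 'm) set \<Rightarrow> bool" where
  "ordered_generators M deg G r \<longleftrightarrow>
    freely_generated M deg G \<and> well_order_on G r \<and>
    (\<forall>l s. (l, s) \<in> r \<and> l \<noteq> s \<longrightarrow> deg l \<le> deg s) \<and>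
    (\<forall>s\<in>G. dif M s \<in> generated_subalgebra M {l. (l, s) \<in> r \<and> l \<noteq> s})"

text \<open>This is the ordinal sum, with all of \<open>G\<close> placed before all of
  \<open>Y\<close>. Its strict part is a union of three well-founded relations, glued along disjoint
  domains and ranges.\<close>

lemma well_order_on_ordered_sum:
  assumes r: "well_order_on G r" and s: "well_order_on Y s" and disj: "Y \<inter> G = {}"
  shows "well_order_on (G \<union> Y) (r \<union> s \<union> G \<times> Y)"
proof -
  have rs: "r \<subseteq> G \<times> G" "s \<subseteq> Y \<times> Y"
    using r s by (auto simp: well_order_on_def linear_order_on_def partial_order_on_def
        preorder_on_def refl_on_def)
  \<comment> \<open>No two steps of \<open>G \<times> Y\<close> can be composed, since
    \<open>G\<close> and \<open>Y\<close> are disjoint.\<close>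
  have "wf (G \<times> Y)"
    using wf_Un[of "{}" "G \<times> Y"] disj by (intro wf_no_loop) auto
  then have "wf ((r - Id) \<union> G \<times> Y)"
    using r rs disj by (intro wf_Un) (auto simp: well_order_on_def)
  then have "wf ((r - Id) \<union> G \<times> Y \<union> (s - Id))"
    by (rule wf_Un) (use s rs disj in \<open>auto simp: well_order_on_def\<close>)
  moreover have "r \<union> s \<union> G \<times> Y - Id = (r - Id) \<union> G \<times> Y \<union> (s - Id)"
    using disj by auto
  moreover have "linear_order_on (G \<union> Y) (r \<union> s \<union> G \<times> Y)"
    unfolding linear_order_on_def partial_order_on_def preorder_on_def
  proof (intro conjI)
    have tr: "trans r" "trans s" "antisym r" "antisym s" "total_on G r" "total_on Y s"
      "refl_on G r" "refl_on Y s"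
      using r s by (auto simp: well_order_on_def linear_order_on_def partial_order_on_def
          preorder_on_def)
    show "refl_on (G \<union> Y) (r \<union> s \<union> G \<times> Y)"
      using tr rs by (auto simp: refl_on_def)
    show "trans (r \<union> s \<union> G \<times> Y)"
      using tr(1,2) rs disj unfolding trans_def by blast
    show "antisym (r \<union> s \<union> G \<times> Y)"
      using tr(3,4) rs disj unfolding antisym_def by blast
    show "total_on (G \<union> Y) (r \<union> s \<union> G \<times> Y)"
      using tr(5,6) unfolding total_on_def by blast
    show "r \<union> s \<union> G \<times> Y \<subseteq> (G \<union> Y) \<times> (G \<union> Y)" using rs by auto
  qed
  ultimately show ?thesis by (simp add: well_order_on_def)
qed

context generator_extension
begin

text \<open>Membership in \<open>carrier M\<close> has to be proved in the same induction, because
  the operations of \<open>M\<close> and \<open>M'\<close> are known to agree only there.\<close>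

lemma generated_subalgebra_mono:
  assumes "x \<in> generated_subalgebra M S" "S \<subseteq> carrier M" "S \<subseteq> S'"
  shows "x \<in> carrier M \<and> x \<in> generated_subalgebra M' S'"
  using assms(1)
proof induction
  interpret R: ring M by (rule I.M.is_ring)
  case one
  show ?case by (simp add: one_eq[symmetric] generated_subalgebra.one)
      (simp add: one_eq)
next
  case (gen x)
  with assms show ?case by (auto intro: generated_subalgebra.gen)
next
  case (smult x c)
  then show ?case
    using generated_subalgebra.smult[of x M' S' c] by (auto simp: smult_eq I.M.smult_closed)
next
  interpret R: ring M by (rule I.M.is_ring)
  case (add x y)
  then show ?case
    using generated_subalgebra.add[of x M' S' y] by (auto simp: add_eq)
next
  interpret R: ring M by (rule I.M.is_ring)
  case (mult x y)
  then show ?case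
    using generated_subalgebra.mult[of x M' S' y] by (auto simp: mult_eq)
qed

text \<open>The new generators follow all old ones and are well-ordered arbitrarily among
  themselves. Their differentials lie in \<open>M\<close>, hence are expressed in \<open>G\<close>,
  all of which precedes them; the degrees stay monotone because old degrees are at most
  \<open>n\<close>.\<close>

lemma ordered_generators_extension:
  assumes free: "freely_generated M' deg' (G \<union> Y)" and ord: "ordered_generators M deg G r"
    and deg: "\<And>s. s \<in> G \<Longrightarrow> deg s \<le> n"
    and z: "\<And>y. y \<in> Y \<Longrightarrow> dif M' y \<in> carrier M"
  shows "\<exists>r'. ordered_generators M' deg' (G \<union> Y) r'"
proof -
  obtain s where s: "well_order_on Y s" using well_order_on by blast
  have r: "well_order_on G r" and rdeg: "\<And>l s. (l, s) \<in> r \<Longrightarrow> l \<noteq> s \<Longrightarrow> deg l \<le> deg s"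
    and rdif: "\<And>s. s \<in> G \<Longrightarrow> dif M s \<in> generated_subalgebra M {l. (l, s) \<in> r \<and> l \<noteq> s}"
    using ord by (auto simp: ordered_generators_def)
  have rs: "r \<subseteq> G \<times> G" "s \<subseteq> Y \<times> Y"
    using r s by (auto simp: well_order_on_def linear_order_on_def partial_order_on_def
        preorder_on_def refl_on_def)
  let ?r = "r \<union> s \<union> G \<times> Y"
  have "deg' l \<le> deg' t" if "(l, t) \<in> ?r" "l \<noteq> t" for l t
    using that rs rdeg[of l t] deg[of l] deg_eq[of l] deg_eq[of t] deg_Y[of l] deg_Y[of t] by auto
  moreover have "dif M' t \<in> generated_subalgebra M' {l. (l, t) \<in> ?r \<and> l \<noteq> t}"
    if "t \<in> G \<union> Y" for t
  proof (cases "t \<in> G")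
    case True
    have "{l. (l, t) \<in> r \<and> l \<noteq> t} \<subseteq> carrier M" using rs V.gen_closed by auto
    from generated_subalgebra_mono[OF rdif[OF True] this, of "{l. (l, t) \<in> ?r \<and> l \<noteq> t}"]
    have "dif M t \<in> generated_subalgebra M' {l. (l, t) \<in> ?r \<and> l \<noteq> t}" by blast
    then show ?thesis by (simp only: dif_eq[OF V.gen_closed[OF True]])
  next
    case False
    with that have t: "t \<in> Y" by simp
    then have "dif M' t \<in> generated_subalgebra M G" using z V.carrier_generated by auto
    from generated_subalgebra_mono[OF this, of "{l. (l, t) \<in> ?r \<and> l \<noteq> t}"] t False
    show ?thesis using V.gen_closed by auto
  qed
  ultimately show ?thesis
    using free well_order_on_ordered_sum[OF r s Y_disjoint]
    unfolding ordered_generators_def by blast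
qed

end

section \<open>Stages of the method\<close>

text \<open>The invariant of the method. One \<open>n\<close> bounds the degrees of generators and
  the range of isomorphism, and it does not move during the y-step for \<open>n + 1\<close>, whose
  generators have degree \<open>n\<close>; the x-step for \<open>n + 1\<close> then raises
  it.\<close>

definition minimal_stage ::
  "'a diff_alg \<Rightarrow> nat \<Rightarrow> 'm diff_alg \<Rightarrow> 'm set \<Rightarrow> ('m \<Rightarrow> 'a) \<Rightarrow> bool" where
  "minimal_stage A n M G \<phi> \<longleftrightarrow>
    differential_algebra M \<and> \<phi> \<in> diff_algebra_hom M A \<and>
    (\<exists>deg r. ordered_generators M deg G r \<and> (\<forall>s\<in>G. deg s \<le> n)) \<and>
    (\<forall>j\<le>n. cohomology_iso M A \<phi> j)"

text \<open>A y-iteration uses this with \<open>n = k\<close>, an x-step with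
  \<open>n = k + 1\<close>; in both cases old degrees do not exceed the new one.\<close>

lemma adds_generators_extension:
  assumes A: "differential_algebra A" and stage: "minimal_stage A k M G \<phi>" "k \<le> n"
    and adds: "adds_generators A n Y z b M G \<phi> M' G' \<phi>'"
    and z: "\<And>y. y \<in> Y \<Longrightarrow> z y \<in> carrier M"
  obtains deg deg' E E' r where
    "generator_extension_over M M' deg deg' G Y E E' n A \<phi> \<phi>'"
    "ordered_generators M' deg' G' r" "\<forall>s\<in>G'. deg' s \<le> n"
proof -
  from stage obtain deg r where M: "differential_algebra M" and hom: "\<phi> \<in> diff_algebra_hom M A"
    and ord: "ordered_generators M deg G r" and deg: "\<forall>s\<in>G. deg s \<le> n"
    unfolding minimal_stage_def by (meson order_trans)
  from adds obtain deg' where M': "differential_algebra M'" and hom': "\<phi>' \<in> diff_algebra_hom M' A"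
    and G': "Y \<inter> G = {}" "G' = G \<union> Y" and free: "freely_generated M' deg' G'"
    and degY: "\<forall>y\<in>Y. deg' y = n" and incl: "(\<lambda>m. m) \<in> diff_algebra_hom M M'"
    and ext: "\<forall>m\<in>carrier M. \<phi>' m = \<phi> m" and dY: "\<forall>y\<in>Y. dif M' y = z y"
    unfolding adds_generators_def by blast
  obtain E where E: "free_evaluation M deg G E"
    using freely_generated_evaluation differential_algebra.axioms(1)[OF M] ord
    unfolding ordered_generators_def by blast
  obtain E' where E': "free_evaluation M' deg' (G \<union> Y) E'"
    using freely_generated_evaluation differential_algebra.axioms(1)[OF M'] free G' by blast
  have I: "diff_algebra_morphism M M' (\<lambda>m. m)" "diff_algebra_morphism M A \<phi>"
    "diff_algebra_morphism M' A \<phi>'"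
    using M M' A incl hom hom'
    by (simp_all add: diff_algebra_morphism_def diff_algebra_morphism_axioms_def)
  have ge: "generator_extension M M' deg deg' G Y E E' n"
    using I(1) E E' G' degY
    by (simp add: generator_extension_def generator_extension_axioms_def)
  have "generator_extension_over M M' deg deg' G Y E E' n A \<phi> \<phi>'"
    using ge I ext
    by (simp add: generator_extension_over_def generator_extension_over_axioms_def)
  moreover obtain r' where "ordered_generators M' deg' G' r'"
    using generator_extension.ordered_generators_extension[OF ge _ ord] free deg dY z G' by auto
  moreover have "\<forall>s\<in>G'. deg' s \<le> n"
    using G' degY deg generator_extension.deg_eq[OF ge] by auto
  ultimately show thesis by (rule that)
qed

lemma y_iteration_minimal_stage:
  assumes A: "differential_algebra A" and stage: "minimal_stage A n M G \<phi>"
    and iter: "y_iteration A (n + 1) M G \<phi> M' G' \<phi>'"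
  shows "minimal_stage A n M' G' \<phi>'"
proof -
  from iter obtain Y z b where z: "\<forall>y\<in>Y. z y \<in> cocycles M (Suc n)"
    and inj: "inj_on (\<lambda>y. cohomology_class M (Suc n) (z y)) Y"
    and basis: "cohomology_basis M (Suc n) (induced_ker M A \<phi> (Suc n))
      ((\<lambda>y. cohomology_class M (Suc n) (z y)) ` Y)"
    and adds: "adds_generators A n Y z b M G \<phi> M' G' \<phi>'"
    unfolding y_iteration_def by auto
  have M: "differential_algebra M" using stage by (simp add: minimal_stage_def)
  have zc: "z y \<in> carrier M" if "y \<in> Y" for y
    using z that differential_algebra.cocycles_closed[OF M] by blast
  obtain deg deg' E E' r where ext: "generator_extension_over M M' deg deg' G Y E E' n A \<phi> \<phi>'"
    and ord: "ordered_generators M' deg' G' r" "\<forall>s\<in>G'. deg' s \<le> n"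
    using adds_generators_extension[OF A stage order_refl adds zc] by blast
  interpret X: generator_extension_over M M' deg deg' G Y E E' n A \<phi> \<phi>' by (rule ext)
  have dY: "dif M' y = z y" if "y \<in> Y" for y using adds that by (simp add: adds_generators_def)
  \<comment> \<open>The classes of the \<open>z y\<close> form a basis of the kernel, so they are
    independent and the new generators create no cocycle of degree \<open>n\<close>.\<close>
  have "cocycles M' n = cocycles M n"
    using X.cocycles_at_independent[OF dY] z inj
      X.I.M.cohomology_basisD(3)[OF X.\<phi>.induced_ker_submodule basis] by blast
  then have "cohomology_iso M' A \<phi>' j" if "j \<le> n" for j
    using that stage X.cohomology_iso_below[of j]
      X.cohomology_iso_transfer[of j] X.coboundaries_upto[of j]
    by (cases "j = n") (auto simp: minimal_stage_def)
  with ord adds show ?thesis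
    by (auto simp: minimal_stage_def adds_generators_def)
qed

text \<open>Termination is encoded in the derivation of \<open>y_step\<close> being finite: each
  iteration preserves the invariant, and injectivity in degree \<open>n + 1\<close> is the condition
  of the final \<open>stop\<close>.\<close>

lemma y_step_minimal_stage:
  assumes "y_step A (n + 1) M G \<phi> M' G' \<phi>'" "differential_algebra A" "minimal_stage A n M G \<phi>"
  shows "minimal_stage A n M' G' \<phi>' \<and> induced_injective M' A \<phi>' (n + 1)"
  using assms(1,3)
proof (induction rule: y_step.induct)
  case (stop M \<phi> G)
  then show ?case by simp
next
  case (iterate M \<phi> G M' G' \<phi>' M'' G'' \<phi>'')
  then show ?case using y_iteration_minimal_stage[OF assms(2)] by blast
qed

text \<open>The generators added here have degree \<open>n + 1\<close>, so degrees up to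
  \<open>n\<close> are untouched. In degree \<open>n + 1\<close> the preceding y-step supplies
  injectivity and the new classes supply surjectivity.\<close>

lemma x_step_minimal_stage:
  assumes A: "differential_algebra A" and stage: "minimal_stage A n M G \<phi>"
    and mono: "induced_injective M A \<phi> (n + 1)"
    and step: "x_step A (n + 1) M G \<phi> M' G' \<phi>'"
  shows "minimal_stage A (n + 1) M' G' \<phi>'"
proof -
  let ?k = "n + 1"
  from step obtain X a B where B: "cohomology_basis A ?k (induced_image M A \<phi> ?k) B"
    and a: "\<forall>x\<in>X. a x \<in> cocycles A ?k"
    and inj: "inj_on (\<lambda>x. cohomology_class A ?k (a x)) X"
    and disj: "B \<inter> (\<lambda>x. cohomology_class A ?k (a x)) ` X = {}"
    and basis: "cohomology_basis A ?k (carrier (cohomology A ?k))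
        (B \<union> (\<lambda>x. cohomology_class A ?k (a x)) ` X)"
    and adds: "adds_generators A ?k X (\<lambda>x. \<zero>\<^bsub>M\<^esub>) a M G \<phi> M' G' \<phi>'"
    unfolding x_step_def by blast
  have "differential_algebra M" using stage by (simp add: minimal_stage_def)
  then interpret M: differential_algebra M .
  have "\<zero>\<^bsub>M\<^esub> \<in> carrier M" using M.grade_closed[OF M.zero_in_grade] .
  then obtain deg deg' E E' r
    where ext: "generator_extension_over M M' deg deg' G X E E' ?k A \<phi> \<phi>'"
      and ord: "ordered_generators M' deg' G' r" "\<forall>s\<in>G'. deg' s \<le> ?k"
    using adds_generators_extension[OF A stage le_add1 adds] by blast
  interpret X: generator_extension_over M M' deg deg' G X E E' ?k A \<phi> \<phi>' by (rule ext)
  have "dif M' x = \<zero>\<^bsub>M\<^esub>" "\<phi>' x = a x" if "x \<in> X" for x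
    using adds that by (simp_all add: adds_generators_def)
  then have "cohomology_iso M' A \<phi>' ?k"
    using a by (intro X.cohomology_iso_at[OF _ _ _ inj B disj basis mono]) auto
  moreover have "cohomology_iso M' A \<phi>' j" if "j \<le> n" for j
    using that stage X.cohomology_iso_below[of j] by (simp add: minimal_stage_def)
  ultimately have "\<forall>j\<le>?k. cohomology_iso M' A \<phi>' j" by (metis le_Suc_eq Suc_eq_plus1)
  with ord adds show ?thesis
    by (auto simp: minimal_stage_def adds_generators_def)
qed

text \<open>Three ranges of degrees: in degree 0 both algebras consist of the scalars; strictly
  between 0 and \<open>k\<^sub>0\<close> the free algebra is zero and \<open>A\<close> has no
  cohomology; in degree \<open>k\<^sub>0\<close> the generators map to a basis.\<close>

lemma first_step_minimal_stage:
  assumes A: "differential_algebra A" and conn: "connected_algebra A"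
    and k0: "0 < k\<^sub>0" and triv: "\<And>j. \<lbrakk>0 < j; j < k\<^sub>0\<rbrakk> \<Longrightarrow> \<not> nontrivial_cohomology A j"
    and first: "first_step A k\<^sub>0 M G \<phi>"
  shows "minimal_stage A k\<^sub>0 M G \<phi>"
proof -
  from first obtain deg where M: "differential_algebra M" and hom: "\<phi> \<in> diff_algebra_hom M A"
    and free: "freely_generated M deg G" and deg: "\<And>x. x \<in> G \<Longrightarrow> deg x = k\<^sub>0"
    and gen: "\<And>x. x \<in> G \<Longrightarrow> dif M x = \<zero>\<^bsub>M\<^esub>" "\<And>x. x \<in> G \<Longrightarrow> \<phi> x \<in> cocycles A k\<^sub>0"
    and inj: "inj_on (\<lambda>x. cohomology_class A k\<^sub>0 (\<phi> x)) G"
    and basis: "cohomology_basis A k\<^sub>0 (carrier (cohomology A k\<^sub>0))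
      ((\<lambda>x. cohomology_class A k\<^sub>0 (\<phi> x)) ` G)"
    unfolding first_step_def by blast
  interpret \<phi>: diff_algebra_morphism M A \<phi>
    using M A hom by (simp add: diff_algebra_morphism_def diff_algebra_morphism_axioms_def)
  obtain E where "free_evaluation M deg G E"
    using freely_generated_evaluation[OF differential_algebra.axioms(1)[OF M] free] by blast
  then interpret E: free_evaluation M deg G E .
  interpret RM: ring M by (rule \<phi>.M.is_ring)
  interpret RA: ring A by (rule \<phi>.A.is_ring)
  interpret VM: module rat_field M by (rule \<phi>.M.module_A)
  interpret VA: vectorspace rat_field A by (rule \<phi>.A.vector_space)
  have one: "\<phi> (c \<odot>\<^bsub>M\<^esub> \<one>\<^bsub>M\<^esub>) = c \<odot>\<^bsub>A\<^esub> \<one>\<^bsub>A\<^esub>" for c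
    using \<phi>.hom_smult[OF RM.one_closed] ring_hom_one[OF \<phi>.hom_ring] by simp

  have "cohomology_iso M A \<phi> 0"
  proof (rule \<phi>.cohomology_isoI)
    fix z assume z: "z \<in> cocycles M 0" "\<phi> z \<in> coboundaries A 0"
    then obtain c where c: "z = c \<odot>\<^bsub>M\<^esub> \<one>\<^bsub>M\<^esub>" by (auto simp: cocycles_def E.grade_zero_eq)
    with z one have "c \<odot>\<^bsub>A\<^esub> \<one>\<^bsub>A\<^esub> = \<zero>\<^bsub>A\<^esub>" by (simp add: coboundaries_def)
    \<comment> \<open>Otherwise scaling by the inverse of \<open>c\<close> would give 1 = 0 in
      \<open>A\<close>, against connectedness.\<close>
    have "c = 0"
    proof (rule ccontr)
      assume "c \<noteq> 0"
      then have "\<one>\<^bsub>A\<^esub> = inverse c \<odot>\<^bsub>A\<^esub> (c \<odot>\<^bsub>A\<^esub> \<one>\<^bsub>A\<^esub>)"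
        using VA.smult_assoc1[of "inverse c" c "\<one>\<^bsub>A\<^esub>"] VA.smult_one[of "\<one>\<^bsub>A\<^esub>"]
        by (simp add: rat_field_def)
      then show False
        using \<open>c \<odot>\<^bsub>A\<^esub> \<one>\<^bsub>A\<^esub> = \<zero>\<^bsub>A\<^esub>\<close> VA.smult_r_null conn
        by (simp add: connected_algebra_def)
    qed
    then show "z \<in> coboundaries M 0"
      using c VM.lmult_0[OF RM.one_closed] by (simp add: coboundaries_def)
  next
    have one0: "\<one>\<^bsub>M\<^esub> \<in> grade M 0"
      unfolding E.grade_zero_eq using VM.smult_one[OF RM.one_closed]
      by (metis rangeI)
    show "carrier (cohomology A 0) \<subseteq> induced_image M A \<phi> 0"
    proof
      fix v assume "v \<in> carrier (cohomology A 0)"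
      then obtain c where v: "v = cohomology_class A 0 (c \<odot>\<^bsub>A\<^esub> \<one>\<^bsub>A\<^esub>)"
        using conn by (auto simp: \<phi>.A.carrier_cohomology cocycles_def connected_algebra_def)
      have "c \<odot>\<^bsub>M\<^esub> \<one>\<^bsub>M\<^esub> \<in> cocycles M 0"
        using one0 \<phi>.M.dif_one[OF one0]
        by (intro \<phi>.M.cocycles_smult) (simp add: cocycles_def)
      then show "v \<in> induced_image M A \<phi> 0"
        unfolding \<phi>.induced_image_eq v using one by (metis image_eqI)
    qed
  qed
  moreover have "cohomology_iso M A \<phi> j" if j: "0 < j" "j < k\<^sub>0" for j
  proof (rule \<phi>.cohomology_isoI)
    fix z assume "z \<in> cocycles M j"
    then have "z = \<zero>\<^bsub>M\<^esub>"
      using E.grade_below_trivial[OF j(1)] j(2) deg by (auto simp: cocycles_def)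
    then show "z \<in> coboundaries M j" by (simp add: \<phi>.M.zero_in_coboundaries)
  next
    show "carrier (cohomology A j) \<subseteq> induced_image M A \<phi> j"
      using triv[OF j] submodule.zero_closed[OF \<phi>.induced_image_submodule]
      by (simp add: nontrivial_cohomology_def)
  qed
  moreover have "cohomology_iso M A \<phi> k\<^sub>0"
  proof (rule \<phi>.cohomology_isoI)
    interpret H: module rat_field "cohomology A k\<^sub>0" by (rule \<phi>.A.cohomology_module)
    note basis' = \<phi>.A.cohomology_basisD[OF \<phi>.A.carrier_cohomology_submodule basis]
    have "x \<in> cocycles M k\<^sub>0" if "x \<in> G" for x
      using E.gen_grade[OF that] deg[OF that] gen(1)[OF that] by (simp add: cocycles_def)
    then have "(\<lambda>x. cohomology_class A k\<^sub>0 (\<phi> x)) ` G \<subseteq> induced_image M A \<phi> k\<^sub>0"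
      unfolding \<phi>.induced_image_eq by auto
    then show "carrier (cohomology A k\<^sub>0) \<subseteq> induced_image M A \<phi> k\<^sub>0"
      using H.span_is_subset[OF _ \<phi>.induced_image_submodule] basis'(2) by metis
    fix x assume x: "x \<in> cocycles M k\<^sub>0" "\<phi> x \<in> coboundaries A k\<^sub>0"
    then have "x \<in> grade M k\<^sub>0" by (simp add: cocycles_def)
    then obtain p where p: "p \<in> carrier (tensor_algebra G)"
      "\<forall>w. p w \<noteq> 0 \<longrightarrow> sum_list (map deg w) = k\<^sub>0" "E p = x" by (rule E.grade_eval)
    have "\<And>y. y \<in> G - {} \<Longrightarrow> deg y = k\<^sub>0" using deg by simp
    \<comment> \<open>Every generator has degree \<open>k\<^sub>0\<close>, so the splitting is taken
      with no old letters at all.\<close>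
    from E.poly_at_degree[OF p(1,2) this] obtain q F c where q: "q \<in> carrier (tensor_algebra {})"
      "\<forall>w. q w \<noteq> 0 \<longrightarrow> sum_list (map deg w) = k\<^sub>0" and F: "finite F" "F \<subseteq> G - {}"
      and Ep: "E p = E q \<oplus>\<^bsub>M\<^esub> (\<Oplus>\<^bsub>M\<^esub>y\<in>F. c y \<odot>\<^bsub>M\<^esub> y)"
      by blast
    \<comment> \<open>Over the empty alphabet only the empty word remains, and its weight is 0
      rather than the positive \<open>k\<^sub>0\<close>.\<close>
    have "q w = 0" for w
      using q k0 by (cases w) (auto simp: carrier_tensor_algebra)
    then have "q = (\<lambda>w. 0)" by (rule ext)
    then have Eq: "E q = \<zero>\<^bsub>M\<^esub>" by (simp add: E.E_zero)
    have Fc: "y \<in> carrier M" if "y \<in> F" for y using that F E.gen_closed by auto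
    then have cF: "(\<lambda>y. c y \<odot>\<^bsub>M\<^esub> y) \<in> F \<rightarrow> carrier M" by (auto intro: \<phi>.M.smult_closed)
    with Ep Eq p(3) have xeq: "x = (\<Oplus>\<^bsub>M\<^esub>y\<in>F. c y \<odot>\<^bsub>M\<^esub> y)" by simp
    have "\<phi> x = (\<Oplus>\<^bsub>A\<^esub>y\<in>F. c y \<odot>\<^bsub>A\<^esub> \<phi> y)"
      unfolding xeq \<phi>.hom_finsum[OF F(1) cF]
      by (rule RA.finsum_cong'[OF refl])
        (use Fc in \<open>auto simp: \<phi>.hom_smult intro!: \<phi>.A.smult_closed \<phi>.hom_closed\<close>)
    moreover from this have "(\<Oplus>\<^bsub>A\<^esub>y\<in>F. c y \<odot>\<^bsub>A\<^esub> \<phi> y) \<in> carrier A"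
      using \<phi>.hom_closed[OF \<phi>.M.cocycles_closed[OF x(1)]] by simp
    \<comment> \<open>The summand zero plays the part of \<open>w\<close> in the independence lemma,
      with \<open>S\<close> empty.\<close>
    ultimately have eq: "\<zero>\<^bsub>A\<^esub> \<oplus>\<^bsub>A\<^esub> (\<Oplus>\<^bsub>A\<^esub>y\<in>F. c y \<odot>\<^bsub>A\<^esub> \<phi> y) \<in> coboundaries A k\<^sub>0"
      using x(2) by simp
    have span: "cohomology_class A k\<^sub>0 \<zero>\<^bsub>A\<^esub> \<in> H.span {}"
      using H.span_is_submodule[of "{}"]
      by (simp add: \<phi>.A.class_zero \<phi>.A.zero_cohomology[symmetric] submodule.zero_closed)
    have c0: "c y = 0" if "y \<in> F" for y
      by (rule \<phi>.A.cohomology_independent[of k\<^sub>0 "{}" \<phi> G "\<zero>\<^bsub>A\<^esub>" F c y])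
        (use basis'(3) inj gen(2) span F eq that \<phi>.A.zero_in_cocycles in auto)
    have "x = (\<Oplus>\<^bsub>M\<^esub>y\<in>F. \<zero>\<^bsub>M\<^esub>)"
      unfolding xeq by (rule RM.finsum_cong'[OF refl]) (use c0 Fc VM.lmult_0 in auto)
    then show "x \<in> coboundaries M k\<^sub>0" by (simp add: \<phi>.M.zero_in_coboundaries)
  qed
  ultimately have "\<forall>j\<le>k\<^sub>0. cohomology_iso M A \<phi> j"
    by (metis le_neq_implies_less not_gr0)
  moreover have "\<exists>r. ordered_generators M deg G r"
  proof -
    \<comment> \<open>All generators are closed and share one degree, so any well-order on them will
      do.\<close>
    obtain r where r: "well_order_on G r" using well_order_on by blast
    then have "r \<subseteq> G \<times> G"
      by (auto simp: well_order_on_def linear_order_on_def partial_order_on_def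
          preorder_on_def refl_on_def)
    moreover have "\<zero>\<^bsub>M\<^esub> \<in> generated_subalgebra M S" for S
      using VM.lmult_0[OF RM.one_closed]
      by (metis generated_subalgebra.one generated_subalgebra.smult)
    ultimately have "ordered_generators M deg G r"
      using r free deg gen(1) by (auto simp: ordered_generators_def)
    then show ?thesis by blast
  qed
  ultimately show ?thesis
    using M hom deg by (auto simp: minimal_stage_def)
qed

lemma reached_after_x_step_minimal_stage:
  assumes "reached_after_x_step A k\<^sub>0 k M G \<phi>"
    and "differential_algebra A" "connected_algebra A" "0 < k\<^sub>0"
    and "\<And>j. \<lbrakk>0 < j; j < k\<^sub>0\<rbrakk> \<Longrightarrow> \<not> nontrivial_cohomology A j"
  shows "minimal_stage A k M G \<phi>"
  using assms(1)
proof (induction rule: reached_after_x_step.induct)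
  case (first M G \<phi>)
  then show ?case using first_step_minimal_stage assms(2-) by blast
next
  case (next_degree k M G \<phi> M' G' \<phi>' M'' G'' \<phi>'')
  then show ?case
    using y_step_minimal_stage x_step_minimal_stage assms(2) by blast
qed

lemma minimal_stage_minimal_model:
  assumes "minimal_stage A i M G \<phi>" "induced_injective M A \<phi> (i + 1)"
  shows "i_minimal_model i A M \<phi>"
proof -
  obtain deg r where "ordered_generators M deg G r" "\<forall>s\<in>G. deg s \<le> i"
    and M: "differential_algebra M"
    using assms(1) unfolding minimal_stage_def by blast
  then have "i_minimal i M"
    unfolding i_minimal_def ordered_generators_def by blast
  moreover have "i_quasi_isomorphism i M A \<phi>"
    using assms unfolding i_quasi_isomorphism_def minimal_stage_def cohomology_iso_def
      induced_injective_def induced_image_def bij_betw_def by simp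
  ultimately show ?thesis by (simp add: i_minimal_model_def)
qed

theorem mainTheorem1:
  fixes A :: "'a diff_alg" and k\<^sub>0 i :: nat
    and M :: "'m diff_alg" and G :: "'m set" and \<phi> :: "'m \<Rightarrow> 'a"
  assumes "differential_algebra A"
    and "connected_algebra A"
    and "finitely_presented A"
    and "\<exists>k>0. nontrivial_cohomology A k"
    and "k\<^sub>0 = (LEAST k. k > 0 \<and> nontrivial_cohomology A k)"
    and "i \<ge> k\<^sub>0"
    and "method_terminates_with A k\<^sub>0 i M G \<phi>"
  shows "i_minimal_model i A M \<phi>"
proof -
  have "0 < k\<^sub>0" using LeastI_ex[OF assms(4)] assms(5) by simp
  moreover have "\<not> nontrivial_cohomology A j" if "0 < j" "j < k\<^sub>0" for j
    using that not_less_Least[of j "\<lambda>k. k > 0 \<and> nontrivial_cohomology A k"] assms(5) by simp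
  moreover obtain M' G' \<phi>' where "reached_after_x_step A k\<^sub>0 i M' G' \<phi>'"
    and y: "y_step A (i + 1) M' G' \<phi>' M G \<phi>"
    using assms(7) unfolding method_terminates_with_def by blast
  ultimately have "minimal_stage A i M' G' \<phi>'"
    using reached_after_x_step_minimal_stage assms(1,2) by blast
  \<comment> \<open>The last y-step, for \<open>i + 1\<close>, keeps the invariant at
    \<open>i\<close> and adds the monomorphism in degree \<open>i + 1\<close>.\<close>
  from y_step_minimal_stage[OF y assms(1) this] show ?thesis
    using minimal_stage_minimal_model by blast
qed

end
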